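(* The following collection principle is $\mathcal I^{\mathrm{cb}}$-interpretable: $$\forall f\le_{\mathbb N\to\mathbb N}1\ \exists n^{\mathbb N}\,C(f,n)\ \to\ \exists k^{\mathbb N}\,\forall f\le_{\mathbb N\to\mathbb N}1\ \exists n\le k\,C(f,n),$$ for arbitrary formulas $C(f,n)$ of the source language (that of $\mathrm{HA}^\omega$).
   Context: Source. $\mathrm{HA}^\omega$ is Heyting arithmetic in all finite types generated by $\sigma\to\tau$ from ground types $\mathbb N$ and $\mathbb B$ (Booleans), with combinators, $0$, successor, recursors, Boolean constants and conditionals; its only relation symbols are logical equalities $\equiv_\sigma$. Formulas use $\bot,\wedge,\to,\forall x^\sigma,\exists x^\sigma$ and the following primitive restricted quantifiers. $n\le k$ abbreviates a quantifier-free equation of type $\mathbb N$. $\forall n\le k\,A$, $\exists n\le k\,A$ are axiomatized as equivalent to $\forall n(n\le k\to A)$, $\exists n(n\le k\wedge A)$; $\forall f\le_{\mathbb N\to\mathbb N}1\,A$, $\exists f\le_{\mathbb N\to\mathbb N}1\,A$ are axiomatized as equivalent to $\forall f^{\mathbb N\to\mathbb N}(\forall n^{\mathbb N}(fn\le1)\to A)$, $\exists f^{\mathbb N\to\mathbb N}(\forall n^{\mathbb N}(fn\le1)\wedge A)$. Target. Target language: the language of $\mathrm{HA}^\omega$ with the extra type constructor $\sigma\mapsto\sigma^*$ (non-empty finite subsets) and constants for singleton, union, indexed union, membership, combinators and recursors for all these types, and $\mathrm m:\mathbb N^*\to\mathbb N$ (maximum). $\mathcal S^\omega_*$: $\mathcal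 S_{\mathbb N}=\mathbb N$, $\mathcal S_{\mathbb B}=\{0,1\}$, $\mathcal S_{\rho\to\sigma}$ all functions, $\mathcal S_{\sigma^*}$ all non-empty finite subsets of $\mathcal S_\sigma$. The target theory $T$ is the set of sentences true in $\mathcal S^\omega_*$. Witnessing types are generated from $\mathbb N$ by $\to$ and $*$; witnessing terms are terms of such types. $\mathcal L^{\mathcal I}$ adds to the language of $\mathrm{HA}^\omega$ (without restricted quantifiers) a unary predicate $\mathcal I_\sigma(x^\sigma)$ for each type. Boldface letters are (possibly empty) tuples; $\forall\boldsymbol b\in\boldsymbol B$ is componentwise. $\mathcal I^{\mathrm{cb}}$ (canonical upon bounding): $\langle\mathcal I_{\mathbb N}(x)\rangle^n$ is $x\le n$; $\langle\mathcal I_{\mathbb B}(i)\rangle$ is true, without witnesses; $\langle\mathcal I_{\rho\to\sigma}(h)\rangle^{\boldsymbol f,\boldsymbol g}_{\boldsymbol a,\boldsymbol d}:\equiv\forall x^\rho(\forall\boldsymbol b\in\boldsymbol g\boldsymbol a\boldsymbol d\,\langle\mathcal I_\rho(x)\rangle^{\boldsymbol a}_{\boldsymbol b}\to\langle\mathcal I_\sigma(hx)\rangle^{\boldsymbol f\boldsymbol a}_{\boldsymbol d})$. $\mathcal U$-interpretation: $\langle x\equiv_\sigma y\rangle$ is $x=y$; $\langle\bot\rangle:\equiv\bot$; $\langle A\wedge B\rangle^{\boldsymbol a,\boldsymbol c}_{\boldsymbol b,\boldsymbol d}:\equiv\langle A\rangle^{\boldsymbol a}_{\boldsymbol b}\wedge\langle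 B\rangle^{\boldsymbol c}_{\boldsymbol d}$; $\langle A\to B\rangle^{\boldsymbol f,\boldsymbol g}_{\boldsymbol a,\boldsymbol d}:\equiv\forall\boldsymbol b\in\boldsymbol g\boldsymbol a\boldsymbol d\,\langle A\rangle^{\boldsymbol a}_{\boldsymbol b}\to\langle B\rangle^{\boldsymbol f\boldsymbol a}_{\boldsymbol d}$; $\langle\forall xA\rangle^{\boldsymbol a}_{\boldsymbol b}:\equiv\forall x\langle A\rangle^{\boldsymbol a}_{\boldsymbol b}$; $\langle\exists xA\rangle^{\boldsymbol a}_{\boldsymbol B}:\equiv\exists x\forall\boldsymbol b\in\boldsymbol B\langle A\rangle^{\boldsymbol a}_{\boldsymbol b}$. $A(\boldsymbol x)$ is $\mathcal U$-interpretable if there are closed witnessing terms $\boldsymbol t$ with $T\vdash\forall\boldsymbol b\langle A(\boldsymbol x)\rangle^{\boldsymbol t}_{\boldsymbol b}$. Relativization: $A^{\mathcal I}$ commutes with connectives; $(\forall x^\sigma A)^{\mathcal I}:\equiv\forall x^\sigma(\mathcal I_\sigma(x)\to A^{\mathcal I})$; $(\exists x^\sigma A)^{\mathcal I}:\equiv\exists x^\sigma(\mathcal I_\sigma(x)\wedge A^{\mathcal I})$; for restricted quantifiers with restricting formula $B(x)$ (namely $n\le k$, resp. $\forall n(fn\le1)$), the quantifier is relativized to $B^{\mathcal I}$ only: $\forall x(B(x)^{\mathcal I}\to A^{\mathcal I})$, $\exists x(B(x)^{\mathcal I}\wedge A^{\mathcal I})$, where $(n\le k)^{\mathcal I}$ is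 $n\le k$ and $(\forall n(fn\le1))^{\mathcal I}$ is $\forall n(\mathcal I_{\mathbb N}(n)\to fn\le1)$. A formula $A(\boldsymbol x)$ is $\mathcal I^{\mathrm{cb}}$-interpretable if $\forall\boldsymbol x(\mathcal I(\boldsymbol x)\to A(\boldsymbol x)^{\mathcal I})$ is $\mathcal U$-interpretable. *)

theory Defs
  imports "HOL-Library.FuncSet"
begin

section \<open>Types, terms, formulas\<close>

datatype ty = N | B | Fun ty ty (infixr "\<leadsto>" 65) | Fin ty

text \<open>The types of the source language are those without the constructor \<open>Fin\<close> (written
  \<open>\<sigma>\<close> with a star in the mathematical text: non-empty finite subsets of \<open>\<sigma>\<close>).\<close>

primrec src_ty :: "ty \<Rightarrow> bool" where
  "src_ty N \<longleftrightarrow> True"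
| "src_ty B \<longleftrightarrow> True"
| "src_ty (\<rho> \<leadsto> \<sigma>) \<longleftrightarrow> src_ty \<rho> \<and> src_ty \<sigma>"
| "src_ty (Fin \<sigma>) \<longleftrightarrow> False"

primrec wit_ty :: "ty \<Rightarrow> bool" where
  "wit_ty N \<longleftrightarrow> True"
| "wit_ty B \<longleftrightarrow> False"
| "wit_ty (\<rho> \<leadsto> \<sigma>) \<longleftrightarrow> wit_ty \<rho> \<and> wit_ty \<sigma>"
| "wit_ty (Fin \<sigma>) \<longleftrightarrow> wit_ty \<sigma>"

text \<open>Variables carry their type.  The variables of source formulas are the \<open>Src i \<sigma>\<close>; the
  interpretation draws the variables it introduces (witnesses, counter-witnesses and other
  bound variables) from the disjoint supply \<open>Aux i \<sigma>\<close>.  Hence quantifiers of the interpreted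
  formula never capture variables of the terms substituted for the witnesses.\<close>

datatype var = Src nat ty | Aux nat ty

primrec var_ty :: "var \<Rightarrow> ty" where
  "var_ty (Src i \<sigma>) = \<sigma>"
| "var_ty (Aux i \<sigma>) = \<sigma>"

datatype const =
    K ty ty | S ty ty ty | Zero | Succ | Rec ty | Tt | Ff | Cond ty
  | Sing ty | Union ty | IUnion ty ty | Mem ty | Maximum

primrec con_ty :: "const \<Rightarrow> ty" where
  "con_ty (K \<sigma> \<tau>) = \<sigma> \<leadsto> \<tau> \<leadsto> \<sigma>"
| "con_ty (S \<rho> \<sigma> \<tau>) = (\<rho> \<leadsto> \<sigma> \<leadsto> \<tau>) \<leadsto> (\<rho> \<leadsto> \<sigma>) \<leadsto> \<rho> \<leadsto> \<tau>"
| "con_ty Zero = N"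
| "con_ty Succ = N \<leadsto> N"
| "con_ty (Rec \<sigma>) = \<sigma> \<leadsto> (N \<leadsto> \<sigma> \<leadsto> \<sigma>) \<leadsto> N \<leadsto> \<sigma>"
| "con_ty Tt = B"
| "con_ty Ff = B"
| "con_ty (Cond \<sigma>) = B \<leadsto> \<sigma> \<leadsto> \<sigma> \<leadsto> \<sigma>"
| "con_ty (Sing \<sigma>) = \<sigma> \<leadsto> Fin \<sigma>"
| "con_ty (Union \<sigma>) = Fin \<sigma> \<leadsto> Fin \<sigma> \<leadsto> Fin \<sigma>"
| "con_ty (IUnion \<sigma> \<tau>) = Fin \<sigma> \<leadsto> (\<sigma> \<leadsto> Fin \<tau>) \<leadsto> Fin \<tau>"
| "con_ty (Mem \<sigma>) = \<sigma> \<leadsto> Fin \<sigma> \<leadsto> B"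
| "con_ty Maximum = Fin N \<leadsto> N"

datatype tm = Var var | Con const | App tm tm (infixl "\<cdot>" 90)

primrec tm_ty :: "tm \<Rightarrow> ty option" where
  "tm_ty (Var x) = Some (var_ty x)"
| "tm_ty (Con c) = Some (con_ty c)"
| "tm_ty (t \<cdot> u) = (case tm_ty t of
      Some (\<rho> \<leadsto> \<sigma>) \<Rightarrow> if tm_ty u = Some \<rho> then Some \<sigma> else None
    | _ \<Rightarrow> None)"

primrec tm_vars :: "tm \<Rightarrow> var set" where
  "tm_vars (Var x) = {x}"
| "tm_vars (Con c) = {}"
| "tm_vars (t \<cdot> u) = tm_vars t \<union> tm_vars u"

text \<open>The symbols of the source language are exactly those of star-free type: the constants
  for finite sets all mention \<open>Fin\<close> in their type.\<close>

primrec src_symbols :: "tm \<Rightarrow> bool" where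
  "src_symbols (Var x) \<longleftrightarrow> (\<exists>i \<sigma>. x = Src i \<sigma> \<and> src_ty \<sigma>)"
| "src_symbols (Con c) \<longleftrightarrow> src_ty (con_ty c)"
| "src_symbols (t \<cdot> u) \<longleftrightarrow> src_symbols t \<and> src_symbols u"

definition src_tm :: "tm \<Rightarrow> ty \<Rightarrow> bool" where
  "src_tm t \<sigma> \<longleftrightarrow> src_symbols t \<and> tm_ty t = Some \<sigma>"

definition closed_wit_tm :: "tm \<Rightarrow> ty \<Rightarrow> bool" where
  "closed_wit_tm t \<tau> \<longleftrightarrow> tm_vars t = {} \<and> tm_ty t = Some \<tau> \<and> wit_ty \<tau>"

text \<open>Truncated subtraction, obtained from the recursor; \<open>n \<le> k\<close> is the equation
  \<open>monus n k \<equiv> 0\<close> of type \<open>N\<close>.\<close>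

definition pred_tm :: tm where
  "pred_tm = Con (Rec N) \<cdot> Con Zero \<cdot> Con (K N N)"

definition monus :: "tm \<Rightarrow> tm \<Rightarrow> tm" where
  "monus t u = Con (Rec N) \<cdot> t \<cdot> (Con (K (N \<leadsto> N) N) \<cdot> pred_tm) \<cdot> u"

definition one_tm :: tm where
  "one_tm = Con Succ \<cdot> Con Zero"

text \<open>Source formulas, with the primitive restricted quantifiers
  \<open>\<forall>n \<le> t\<close>, \<open>\<exists>n \<le> t\<close>, \<open>\<forall>f \<le> 1\<close>, \<open>\<exists>f \<le> 1\<close>.  A binder with index \<open>i\<close> binds \<open>Src i \<sigma>\<close>, where
  \<open>\<sigma>\<close> is \<open>N\<close> for the first two restricted quantifiers and \<open>N \<leadsto> N\<close> for the last two.\<close>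

datatype sfm =
    SEq ty tm tm | SBot | SAnd sfm sfm | SImp sfm sfm
  | SAll nat ty sfm | SEx nat ty sfm
  | SAllLe nat tm sfm | SExLe nat tm sfm
  | SAllLe1 nat sfm | SExLe1 nat sfm

primrec src_fm :: "sfm \<Rightarrow> bool" where
  "src_fm (SEq \<sigma> t u) \<longleftrightarrow> src_tm t \<sigma> \<and> src_tm u \<sigma>"
| "src_fm SBot \<longleftrightarrow> True"
| "src_fm (SAnd A A') \<longleftrightarrow> src_fm A \<and> src_fm A'"
| "src_fm (SImp A A') \<longleftrightarrow> src_fm A \<and> src_fm A'"
| "src_fm (SAll i \<sigma> A) \<longleftrightarrow> src_ty \<sigma> \<and> src_fm A"
| "src_fm (SEx i \<sigma> A) \<longleftrightarrow> src_ty \<sigma> \<and> src_fm A"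
| "src_fm (SAllLe i t A) \<longleftrightarrow> src_tm t N \<and> Src i N \<notin> tm_vars t \<and> src_fm A"
| "src_fm (SExLe i t A) \<longleftrightarrow> src_tm t N \<and> Src i N \<notin> tm_vars t \<and> src_fm A"
| "src_fm (SAllLe1 i A) \<longleftrightarrow> src_fm A"
| "src_fm (SExLe1 i A) \<longleftrightarrow> src_fm A"

primrec free_vars :: "sfm \<Rightarrow> var set" where
  "free_vars (SEq \<sigma> t u) = tm_vars t \<union> tm_vars u"
| "free_vars SBot = {}"
| "free_vars (SAnd A A') = free_vars A \<union> free_vars A'"
| "free_vars (SImp A A') = free_vars A \<union> free_vars A'"
| "free_vars (SAll i \<sigma> A) = free_vars A - {Src i \<sigma>}"
| "free_vars (SEx i \<sigma> A) = free_vars A - {Src i \<sigma>}"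
| "free_vars (SAllLe i t A) = tm_vars t \<union> (free_vars A - {Src i N})"
| "free_vars (SExLe i t A) = tm_vars t \<union> (free_vars A - {Src i N})"
| "free_vars (SAllLe1 i A) = free_vars A - {Src i (N \<leadsto> N)}"
| "free_vars (SExLe1 i A) = free_vars A - {Src i (N \<leadsto> N)}"

text \<open>Formulas with the predicates \<open>I\<^sub>\<sigma>\<close>, and formulas of the target language.\<close>

datatype ifm =
    IEq ty tm tm | IBot | IPred ty tm | IAnd ifm ifm | IImp ifm ifm
  | IAll nat ty ifm | IEx nat ty ifm

datatype tfm =
    TEq ty tm tm | TBot | TAnd tfm tfm | TImp tfm tfm | TAll var tfm | TEx var tfm

definition ITop :: ifm where
  "ITop = IImp IBot IBot"

definition TTop :: tfm where
  "TTop = TImp TBot TBot"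

definition ILe :: "tm \<Rightarrow> tm \<Rightarrow> ifm" where
  "ILe t u = IEq N (monus t u) (Con Zero)"

definition TLe :: "tm \<Rightarrow> tm \<Rightarrow> tfm" where
  "TLe t u = TEq N (monus t u) (Con Zero)"

definition TMem :: "var \<Rightarrow> tm \<Rightarrow> tfm" where
  "TMem b t = TEq B (Con (Mem (var_ty b)) \<cdot> Var b \<cdot> t) (Con Tt)"


section \<open>The full set-theoretic structure with non-empty finite subsets\<close>

text \<open>Plain HOL can neither construct a type containing the carriers of all finite types at
  once (their cardinalities are unbounded in the hierarchy of iterated power sets of the natural
  numbers) nor define a truth predicate for this structure.  So the structure is given, up to
  isomorphism, by carriers inside a type \<open>'v\<close> for which the standard representation maps are
  bijections onto the natural numbers, the Booleans, all functions, and all non-empty finite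
  subsets, respectively.  These conditions determine the structure uniquely up to isomorphism;
  they are satisfied, e.g., by the disjoint union of its carriers inside any type that
  models the sets of rank below \<open>\<omega> + \<omega>\<close>.\<close>

record 'v struct =
  dom :: "ty \<Rightarrow> 'v set"
  num :: "nat \<Rightarrow> 'v"
  boole :: "bool \<Rightarrow> 'v"
  app :: "'v \<Rightarrow> 'v \<Rightarrow> 'v"
  elems :: "'v \<Rightarrow> 'v set"

definition full_struct :: "'v struct \<Rightarrow> bool" where
  "full_struct M \<longleftrightarrow>
     bij_betw (num M) UNIV (dom M N) \<and>
     bij_betw (boole M) UNIV (dom M B) \<and>
     (\<forall>\<rho> \<sigma>. bij_betw (\<lambda>h. restrict (app M h) (dom M \<rho>)) (dom M (\<rho> \<leadsto> \<sigma>))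
              (dom M \<rho> \<rightarrow>\<^sub>E dom M \<sigma>)) \<and>
     (\<forall>\<sigma>. bij_betw (elems M) (dom M (Fin \<sigma>)) {X. X \<subseteq> dom M \<sigma> \<and> finite X \<and> X \<noteq> {}})"

definition lam :: "'v struct \<Rightarrow> ty \<Rightarrow> ty \<Rightarrow> ('v \<Rightarrow> 'v) \<Rightarrow> 'v" where
  "lam M \<rho> \<sigma> F = (THE h. h \<in> dom M (\<rho> \<leadsto> \<sigma>) \<and> (\<forall>x \<in> dom M \<rho>. app M h x = F x))"

definition fin_set :: "'v struct \<Rightarrow> ty \<Rightarrow> 'v set \<Rightarrow> 'v" where
  "fin_set M \<sigma> X = (THE s. s \<in> dom M (Fin \<sigma>) \<and> elems M s = X)"

definition nat_of :: "'v struct \<Rightarrow> 'v \<Rightarrow> nat" where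
  "nat_of M = the_inv (num M)"

primrec con_val :: "'v struct \<Rightarrow> const \<Rightarrow> 'v" where
  "con_val M (K \<sigma> \<tau>) = lam M \<sigma> (\<tau> \<leadsto> \<sigma>) (\<lambda>x. lam M \<tau> \<sigma> (\<lambda>y. x))"
| "con_val M (S \<rho> \<sigma> \<tau>) =
     lam M (\<rho> \<leadsto> \<sigma> \<leadsto> \<tau>) ((\<rho> \<leadsto> \<sigma>) \<leadsto> \<rho> \<leadsto> \<tau>) (\<lambda>x.
       lam M (\<rho> \<leadsto> \<sigma>) (\<rho> \<leadsto> \<tau>) (\<lambda>y.
         lam M \<rho> \<tau> (\<lambda>z. app M (app M x z) (app M y z))))"
| "con_val M Zero = num M 0"
| "con_val M Succ = lam M N N (\<lambda>n. num M (Suc (nat_of M n)))"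
| "con_val M (Rec \<sigma>) =
     lam M \<sigma> ((N \<leadsto> \<sigma> \<leadsto> \<sigma>) \<leadsto> N \<leadsto> \<sigma>) (\<lambda>x.
       lam M (N \<leadsto> \<sigma> \<leadsto> \<sigma>) (N \<leadsto> \<sigma>) (\<lambda>y.
         lam M N \<sigma> (\<lambda>n. rec_nat x (\<lambda>m r. app M (app M y (num M m)) r) (nat_of M n))))"
| "con_val M Tt = boole M True"
| "con_val M Ff = boole M False"
| "con_val M (Cond \<sigma>) =
     lam M B (\<sigma> \<leadsto> \<sigma> \<leadsto> \<sigma>) (\<lambda>b. lam M \<sigma> (\<sigma> \<leadsto> \<sigma>) (\<lambda>x. lam M \<sigma> \<sigma> (\<lambda>y.
       if b = boole M True then x else y)))"
| "con_val M (Sing \<sigma>) = lam M \<sigma> (Fin \<sigma>) (\<lambda>x. fin_set M \<sigma> {x})"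
| "con_val M (Union \<sigma>) =
     lam M (Fin \<sigma>) (Fin \<sigma> \<leadsto> Fin \<sigma>) (\<lambda>s. lam M (Fin \<sigma>) (Fin \<sigma>) (\<lambda>s'.
       fin_set M \<sigma> (elems M s \<union> elems M s')))"
| "con_val M (IUnion \<sigma> \<tau>) =
     lam M (Fin \<sigma>) ((\<sigma> \<leadsto> Fin \<tau>) \<leadsto> Fin \<tau>) (\<lambda>s. lam M (\<sigma> \<leadsto> Fin \<tau>) (Fin \<tau>) (\<lambda>h.
       fin_set M \<tau> (\<Union>x \<in> elems M s. elems M (app M h x))))"
| "con_val M (Mem \<sigma>) =
     lam M \<sigma> (Fin \<sigma> \<leadsto> B) (\<lambda>x. lam M (Fin \<sigma>) B (\<lambda>s. boole M (x \<in> elems M s)))"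
| "con_val M Maximum = lam M (Fin N) N (\<lambda>s. num M (Max (nat_of M ` elems M s)))"

primrec tm_val :: "'v struct \<Rightarrow> (var \<Rightarrow> 'v) \<Rightarrow> tm \<Rightarrow> 'v" where
  "tm_val M e (Var x) = e x"
| "tm_val M e (Con c) = con_val M c"
| "tm_val M e (t \<cdot> u) = app M (tm_val M e t) (tm_val M e u)"

primrec sat :: "'v struct \<Rightarrow> (var \<Rightarrow> 'v) \<Rightarrow> tfm \<Rightarrow> bool" where
  "sat M e (TEq \<sigma> t u) \<longleftrightarrow> tm_val M e t = tm_val M e u"
| "sat M e TBot \<longleftrightarrow> False"
| "sat M e (TAnd A A') \<longleftrightarrow> sat M e A \<and> sat M e A'"
| "sat M e (TImp A A') \<longleftrightarrow> (sat M e A \<longrightarrow> sat M e A')"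
| "sat M e (TAll x A) \<longleftrightarrow> (\<forall>v \<in> dom M (var_ty x). sat M (e(x := v)) A)"
| "sat M e (TEx x A) \<longleftrightarrow> (\<exists>v \<in> dom M (var_ty x). sat M (e(x := v)) A)"

text \<open>The target theory consists of the sentences true in the structure; it therefore proves an
  open formula iff the universal closure of that formula is true.\<close>

definition T_proves :: "'v struct \<Rightarrow> tfm \<Rightarrow> bool" where
  "T_proves M A \<longleftrightarrow> (\<forall>e. (\<forall>x. e x \<in> dom M (var_ty x)) \<longrightarrow> sat M e A)"


section \<open>The interpretation\<close>

definition funs :: "ty list \<Rightarrow> ty \<Rightarrow> ty" where
  "funs \<sigma>s \<tau> = foldr Fun \<sigma>s \<tau>"

definition apps :: "tm \<Rightarrow> tm list \<Rightarrow> tm" where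
  "apps t us = foldl App t us"

text \<open>Types of the witnesses \<open>f, g\<close> of an implication whose premise has witnesses
  of types \<open>as\<close> and counter-witnesses of types \<open>bs\<close>, and whose conclusion has witnesses of
  types \<open>cs\<close> and counter-witnesses of types \<open>ds\<close>.\<close>

definition imp_wit :: "ty list \<Rightarrow> ty list \<Rightarrow> ty list \<Rightarrow> ty list \<Rightarrow> ty list" where
  "imp_wit as bs cs ds = map (funs as) cs @ map (\<lambda>\<beta>. funs (as @ ds) (Fin \<beta>)) bs"

text \<open>Types of the witnesses and of the counter-witnesses of \<open>I\<^sub>\<sigma>\<close>, for star-free \<open>\<sigma>\<close>
  (the predicate does not exist for other types).\<close>

primrec I_types :: "ty \<Rightarrow> ty list \<times> ty list" where
  "I_types N = ([N], [])"
| "I_types B = ([], [])"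
| "I_types (\<rho> \<leadsto> \<sigma>) =
     (let (as, bs) = I_types \<rho>; (cs, ds) = I_types \<sigma> in (imp_wit as bs cs ds, as @ ds))"
| "I_types (Fin \<sigma>) = ([], [])"

primrec interp_types :: "ifm \<Rightarrow> ty list \<times> ty list" where
  "interp_types (IEq \<sigma> t u) = ([], [])"
| "interp_types IBot = ([], [])"
| "interp_types (IPred \<sigma> t) = I_types \<sigma>"
| "interp_types (IAnd A A') =
     (let (as, bs) = interp_types A; (cs, ds) = interp_types A' in (as @ cs, bs @ ds))"
| "interp_types (IImp A A') =
     (let (as, bs) = interp_types A; (cs, ds) = interp_types A'
      in (imp_wit as bs cs ds, as @ ds))"
| "interp_types (IAll i \<sigma> A) = interp_types A"
| "interp_types (IEx i \<sigma> A) = (let (as, bs) = interp_types A in (as, map Fin bs))"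

definition wit_types :: "ifm \<Rightarrow> ty list" where
  "wit_types A = fst (interp_types A)"

definition counter_types :: "ifm \<Rightarrow> ty list" where
  "counter_types A = snd (interp_types A)"

definition fresh :: "nat \<Rightarrow> ty list \<Rightarrow> var list" where
  "fresh k \<sigma>s = map2 Aux [k..<k + length \<sigma>s] \<sigma>s"

definition TAlls :: "var list \<Rightarrow> tfm \<Rightarrow> tfm" where
  "TAlls xs A = foldr TAll xs A"

text \<open>\<open>\<forall>b\<^sub>1 \<in> B\<^sub>1 \<dots> \<forall>b\<^sub>n \<in> B\<^sub>n A\<close>\<close>

definition TBalls :: "var list \<Rightarrow> tm list \<Rightarrow> tfm \<Rightarrow> tfm" where
  "TBalls bs Bs A = foldr (\<lambda>(b, t) A'. TAll b (TImp (TMem b t) A')) (zip bs Bs) A"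

text \<open>The interpretation of an implication, shared by the clause for \<open>\<rightarrow>\<close> and the one for
  \<open>I\<close> at function types.  Here \<open>P\<close> and \<open>Q\<close> send a fresh-variable index, witnesses and
  counter-witnesses to the interpretation of premise and conclusion; \<open>nf\<close> is the number of
  witnesses of the conclusion and \<open>na\<close> that of the premise, so that the witnesses \<open>ws\<close>
  split into \<open>f, g\<close> and the counter-witnesses \<open>cs\<close> into \<open>a, d\<close>.  The terms \<open>ws\<close>, \<open>cs\<close> contain
  no \<open>Aux i \<sigma>\<close> with \<open>i \<ge> k\<close>.\<close>

definition imp_interp ::
  "nat \<Rightarrow> nat \<Rightarrow> ty list \<Rightarrow> (nat \<Rightarrow> tm list \<Rightarrow> tm list \<Rightarrow> tfm) \<Rightarrow> (nat \<Rightarrow> tm list \<Rightarrow> tm list \<Rightarrow> tfm)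
     \<Rightarrow> nat \<Rightarrow> tm list \<Rightarrow> tm list \<Rightarrow> tfm" where
  "imp_interp na nf \<beta>s P Q k ws cs =
     (let fs = take nf ws; gs = drop nf ws; as = take na cs; ds = drop na cs;
          bs = fresh k \<beta>s
      in TImp (TBalls bs (map (\<lambda>g. apps g (as @ ds)) gs) (P (k + length \<beta>s) as (map Var bs)))
              (Q k (map (\<lambda>f. apps f as) fs) ds))"

primrec I_cb :: "ty \<Rightarrow> tm \<Rightarrow> nat \<Rightarrow> tm list \<Rightarrow> tm list \<Rightarrow> tfm" where
  "I_cb N t k ws cs = TLe t (hd ws)"
| "I_cb B t k ws cs = TTop"
| "I_cb (\<rho> \<leadsto> \<sigma>) t k ws cs =
     (let x = Aux k \<rho> in
      TAll x (imp_interp (length (fst (I_types \<rho>))) (length (fst (I_types \<sigma>))) (snd (I_types \<rho>))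
               (I_cb \<rho> (Var x)) (I_cb \<sigma> (t \<cdot> Var x)) (Suc k) ws cs))"
| "I_cb (Fin \<sigma>) t k ws cs = TTop"

text \<open>\<open>U_interp A k ws cs\<close> is \<open>\<langle>A\<rangle>\<close> with upper index \<open>ws\<close> and lower index \<open>cs\<close>; the variables
  it introduces are \<open>Aux i \<sigma>\<close> with \<open>i \<ge> k\<close>.\<close>

primrec U_interp :: "ifm \<Rightarrow> nat \<Rightarrow> tm list \<Rightarrow> tm list \<Rightarrow> tfm" where
  "U_interp (IEq \<sigma> t u) k ws cs = TEq \<sigma> t u"
| "U_interp IBot k ws cs = TBot"
| "U_interp (IPred \<sigma> t) k ws cs = I_cb \<sigma> t k ws cs"
| "U_interp (IAnd A A') k ws cs =
     (let m = length (wit_types A); n = length (counter_types A) in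
      TAnd (U_interp A k (take m ws) (take n cs)) (U_interp A' k (drop m ws) (drop n cs)))"
| "U_interp (IImp A A') k ws cs =
     imp_interp (length (wit_types A)) (length (wit_types A')) (counter_types A)
       (U_interp A) (U_interp A') k ws cs"
| "U_interp (IAll i \<sigma> A) k ws cs = TAll (Src i \<sigma>) (U_interp A k ws cs)"
| "U_interp (IEx i \<sigma> A) k ws cs =
     (let bs = fresh k (counter_types A) in
      TEx (Src i \<sigma>) (TBalls bs cs (U_interp A (k + length bs) ws (map Var bs))))"

definition U_interpretable :: "'v struct \<Rightarrow> ifm \<Rightarrow> bool" where
  "U_interpretable M A \<longleftrightarrow>
     (\<exists>ts. list_all2 closed_wit_tm ts (wit_types A) \<and>
        (let bs = fresh 0 (counter_types A) in
         T_proves M (TAlls bs (U_interp A (length bs) ts (map Var bs)))))"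

text \<open>The bound variable in the relativization of \<open>\<forall>n (f n \<le> 1)\<close> differs from \<open>f\<close>, since the
  types differ.\<close>

definition I_le1 :: "nat \<Rightarrow> ifm" where
  "I_le1 i = IAll 0 N (IImp (IPred N (Var (Src 0 N)))
                           (ILe (Var (Src i (N \<leadsto> N)) \<cdot> Var (Src 0 N)) one_tm))"

primrec relativize :: "sfm \<Rightarrow> ifm" where
  "relativize (SEq \<sigma> t u) = IEq \<sigma> t u"
| "relativize SBot = IBot"
| "relativize (SAnd A A') = IAnd (relativize A) (relativize A')"
| "relativize (SImp A A') = IImp (relativize A) (relativize A')"
| "relativize (SAll i \<sigma> A) = IAll i \<sigma> (IImp (IPred \<sigma> (Var (Src i \<sigma>))) (relativize A))"
| "relativize (SEx i \<sigma> A) = IEx i \<sigma> (IAnd (IPred \<sigma> (Var (Src i \<sigma>))) (relativize A))"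
| "relativize (SAllLe i t A) = IAll i N (IImp (ILe (Var (Src i N)) t) (relativize A))"
| "relativize (SExLe i t A) = IEx i N (IAnd (ILe (Var (Src i N)) t) (relativize A))"
| "relativize (SAllLe1 i A) = IAll i (N \<leadsto> N) (IImp (I_le1 i) (relativize A))"
| "relativize (SExLe1 i A) = IEx i (N \<leadsto> N) (IAnd (I_le1 i) (relativize A))"

text \<open>\<open>\<forall>x\<^sub>1 \<dots> x\<^sub>n (I(x\<^sub>1) \<and> \<dots> \<and> I(x\<^sub>n) \<and> \<top> \<rightarrow> A)\<close>; the final \<open>\<top>\<close> takes care of \<open>n = 0\<close> and has neither
  witnesses nor counter-witnesses.\<close>

definition I_closure :: "(nat \<times> ty) list \<Rightarrow> ifm \<Rightarrow> ifm" where
  "I_closure xs A =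
     foldr (\<lambda>(i, \<sigma>). IAll i \<sigma>) xs
       (IImp (foldr (\<lambda>(i, \<sigma>). IAnd (IPred \<sigma> (Var (Src i \<sigma>)))) xs ITop) A)"

text \<open>The free variables are taken in an arbitrary order.\<close>

definition I_cb_interpretable :: "'v struct \<Rightarrow> sfm \<Rightarrow> bool" where
  "I_cb_interpretable M A \<longleftrightarrow>
     (\<forall>xs. distinct xs \<and> (\<lambda>(i, \<sigma>). Src i \<sigma>) ` set xs = free_vars A
        \<longrightarrow> U_interpretable M (I_closure xs (relativize A)))"

text \<open>With \<open>f = Src i (N \<leadsto> N)\<close>, \<open>n = Src j N\<close>, \<open>k = Src l N\<close>:
  \<open>\<forall>f \<le> 1 \<exists>n C \<rightarrow> \<exists>k \<forall>f \<le> 1 \<exists>n \<le> k C\<close>.\<close>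

definition collection :: "nat \<Rightarrow> nat \<Rightarrow> nat \<Rightarrow> sfm \<Rightarrow> sfm" where
  "collection i j l C =
     SImp (SAllLe1 i (SEx j N C))
          (SEx l N (SAllLe1 i (SExLe j (Var (Src l N)) C)))"

end

theory Submission
  imports Defs
begin

text \<open>The premise and the conclusion of the collection principle have the same witnesses: a bound
  \<open>w\<close> for \<open>n\<close> resp. \<open>k\<close>, the witnesses of \<open>C\<close>, and a function producing counter-witnesses
  for the restriction on \<open>f\<close>.  Taking \<open>k = w\<close>, the identity realizes the implication, since the
  premise only asserts an \<open>n \<le> w\<close> for every \<open>f\<close>.  The witnesses are thus projections,
  and the interpretation of the free variables is irrelevant.  Bound variables are harmless because
  the truth value of the interpretation depends only on the values of the witnesses, of the
  counter-witnesses and of the free variables of the formula.\<close>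

section \<open>The structure\<close>

text \<open>\<open>lam\<close> is a definite description: surjectivity of the representation map
  supplies a code for \<open>F\<close>, and injectivity makes the code unique.\<close>

lemma lam_props:
  assumes "full_struct M" "\<And>x. x \<in> dom M \<rho> \<Longrightarrow> F x \<in> dom M \<sigma>"
  shows lam_in_dom: "lam M \<rho> \<sigma> F \<in> dom M (\<rho> \<leadsto> \<sigma>)"
    and app_lam: "x \<in> dom M \<rho> \<Longrightarrow> app M (lam M \<rho> \<sigma> F) x = F x"
proof -
  let ?r = "\<lambda>h. restrict (app M h) (dom M \<rho>)"
  have bij: "bij_betw ?r
      (dom M (\<rho> \<leadsto> \<sigma>)) (dom M \<rho> \<rightarrow>\<^sub>E dom M \<sigma>)"
    using assms(1) by (simp add: full_struct_def)
  have "restrict F (dom M \<rho>) \<in> dom M \<rho> \<rightarrow>\<^sub>E dom M \<sigma>" using assms(2) by auto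
  then obtain h where h: "h \<in> dom M (\<rho> \<leadsto> \<sigma>)" "?r h = restrict F (dom M \<rho>)"
    using bij by (metis (no_types, lifting) bij_betw_imp_surj_on imageE)
  have agree: "app M h x = F x" if "x \<in> dom M \<rho>" for x
    using fun_cong[OF h(2), of x] that by simp
  have unique: "h' = h" if "h' \<in> dom M (\<rho> \<leadsto> \<sigma>)" "\<forall>x\<in>dom M \<rho>. app M h' x = F x" for h'
  proof -
    have "?r h' = ?r h" using that(2) agree by (auto simp: restrict_def)
    then show ?thesis using bij that(1) h(1) by (meson bij_betw_imp_inj_on inj_onD)
  qed
  have "lam M \<rho> \<sigma> F = h"
    unfolding lam_def using h(1) agree unique by (intro the_equality) blast+
  then show "lam M \<rho> \<sigma> F \<in> dom M (\<rho> \<leadsto> \<sigma>)" and "x \<in> dom M \<rho> \<Longrightarrow> app M (lam M \<rho> \<sigma> F) x = F x"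
    using h(1) agree by auto
qed

lemma app_in_dom:
  assumes "full_struct M" "h \<in> dom M (\<rho> \<leadsto> \<sigma>)" "x \<in> dom M \<rho>"
  shows "app M h x \<in> dom M \<sigma>"
proof -
  have "bij_betw (\<lambda>h. restrict (app M h) (dom M \<rho>)) (dom M (\<rho> \<leadsto> \<sigma>)) (dom M \<rho> \<rightarrow>\<^sub>E dom M \<sigma>)"
    using assms(1) by (simp add: full_struct_def)
  from bij_betw_apply[OF this assms(2)]
  have "restrict (app M h) (dom M \<rho>) \<in> dom M \<rho> \<rightarrow>\<^sub>E dom M \<sigma>" .
  then show ?thesis using assms(3) by (auto dest: PiE_mem)
qed

lemma num_in_dom: "full_struct M \<Longrightarrow> num M n \<in> dom M N"
  by (auto simp: full_struct_def bij_betw_def)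

lemma nat_of_num: "full_struct M \<Longrightarrow> nat_of M (num M n) = n"
  by (auto simp: full_struct_def bij_betw_def nat_of_def the_inv_f_f)

lemma dom_N_cases:
  assumes "full_struct M" "x \<in> dom M N"
  obtains n where "x = num M n"
proof -
  have "x \<in> range (num M)" using assms by (simp add: full_struct_def bij_betw_def)
  then show ?thesis using that by blast
qed

section \<open>Typing and computation rules of the combinators and the recursor\<close>

lemma K_props:
  assumes "full_struct M"
  shows K_in_dom: "con_val M (K \<sigma> \<tau>) \<in> dom M (\<sigma> \<leadsto> \<tau> \<leadsto> \<sigma>)"
    and app_K: "x \<in> dom M \<sigma> \<Longrightarrow> y \<in> dom M \<tau> \<Longrightarrow> app M (app M (con_val M (K \<sigma> \<tau>)) x) y = x"
  using assms by (simp_all add: lam_in_dom app_lam)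

lemma S_props:
  assumes "full_struct M"
  shows S_in_dom: "con_val M (S \<rho> \<sigma> \<tau>) \<in> dom M ((\<rho> \<leadsto> \<sigma> \<leadsto> \<tau>) \<leadsto> (\<rho> \<leadsto> \<sigma>) \<leadsto> \<rho> \<leadsto> \<tau>)"
    and app_S: "x \<in> dom M (\<rho> \<leadsto> \<sigma> \<leadsto> \<tau>) \<Longrightarrow> y \<in> dom M (\<rho> \<leadsto> \<sigma>) \<Longrightarrow> z \<in> dom M \<rho> \<Longrightarrow>
      app M (app M (app M (con_val M (S \<rho> \<sigma> \<tau>)) x) y) z = app M (app M x z) (app M y z)"
proof -
  \<comment> \<open>Each nested abstraction computes only if its body lands in the right
    carrier.\<close>
  have 1: "app M (app M x z) (app M y z) \<in> dom M \<tau>"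
    if "x \<in> dom M (\<rho> \<leadsto> \<sigma> \<leadsto> \<tau>)" "y \<in> dom M (\<rho> \<leadsto> \<sigma>)" "z \<in> dom M \<rho>" for x y z
    using that by (meson app_in_dom assms)
  show "con_val M (S \<rho> \<sigma> \<tau>) \<in> dom M ((\<rho> \<leadsto> \<sigma> \<leadsto> \<tau>) \<leadsto> (\<rho> \<leadsto> \<sigma>) \<leadsto> \<rho> \<leadsto> \<tau>)"
    using assms 1 by (simp add: lam_in_dom)
  show "x \<in> dom M (\<rho> \<leadsto> \<sigma> \<leadsto> \<tau>) \<Longrightarrow> y \<in> dom M (\<rho> \<leadsto> \<sigma>) \<Longrightarrow> z \<in> dom M \<rho> \<Longrightarrow>
      app M (app M (app M (con_val M (S \<rho> \<sigma> \<tau>)) x) y) z = app M (app M x z) (app M y z)"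
    using assms 1 by (simp add: lam_in_dom app_lam)
qed

lemma Rec_props:
  assumes "full_struct M"
  shows Rec_in_dom: "con_val M (Rec \<sigma>) \<in> dom M (\<sigma> \<leadsto> (N \<leadsto> \<sigma> \<leadsto> \<sigma>) \<leadsto> N \<leadsto> \<sigma>)"
    and app_Rec: "x \<in> dom M \<sigma> \<Longrightarrow> y \<in> dom M (N \<leadsto> \<sigma> \<leadsto> \<sigma>) \<Longrightarrow>
      app M (app M (app M (con_val M (Rec \<sigma>)) x) y) (num M n)
        = rec_nat x (\<lambda>m r. app M (app M y (num M m)) r) n"
proof -
  \<comment> \<open>All iterates stay in the carrier, so the innermost abstraction of
    \<open>Rec\<close> is well typed.\<close>
  have 1: "rec_nat x (\<lambda>m r. app M (app M y (num M m)) r) n \<in> dom M \<sigma>"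
    if "x \<in> dom M \<sigma>" "y \<in> dom M (N \<leadsto> \<sigma> \<leadsto> \<sigma>)" for x y n
    using that by (induction n) (auto intro: app_in_dom[OF assms] num_in_dom[OF assms])
  show "con_val M (Rec \<sigma>) \<in> dom M (\<sigma> \<leadsto> (N \<leadsto> \<sigma> \<leadsto> \<sigma>) \<leadsto> N \<leadsto> \<sigma>)"
    using assms 1 by (simp add: lam_in_dom)
  show "x \<in> dom M \<sigma> \<Longrightarrow> y \<in> dom M (N \<leadsto> \<sigma> \<leadsto> \<sigma>) \<Longrightarrow>
      app M (app M (app M (con_val M (Rec \<sigma>)) x) y) (num M n)
        = rec_nat x (\<lambda>m r. app M (app M y (num M m)) r) n"
    using assms 1 by (simp add: lam_in_dom app_lam num_in_dom nat_of_num)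
qed

text \<open>Subtraction on values instead of terms. As \<open>pred_tm\<close> is closed, the
  environment \<open>undefined\<close> is a harmless default.\<close>

definition monus_val :: "'v struct \<Rightarrow> 'v \<Rightarrow> 'v \<Rightarrow> 'v" where
  "monus_val M x y = app M (app M (app M (con_val M (Rec N)) x)
     (app M (con_val M (K (N \<leadsto> N) N)) (tm_val M undefined pred_tm))) y"

lemma tm_val_monus: "tm_val M e (monus t u) = monus_val M (tm_val M e t) (tm_val M e u)"
  by (simp add: monus_def monus_val_def pred_tm_def del: con_val.simps)

text \<open>The arithmetic behind the inequality w \<le> w for the chosen bound: iterating the
  predecessor is truncated subtraction on the natural numbers, and a - a = 0.\<close>

lemma monus_val_self:
  assumes M: "full_struct M" and "x \<in> dom M N"
  shows "monus_val M x x = num M 0"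
proof -
  let ?p = "tm_val M undefined pred_tm"
  have p: "?p \<in> dom M (N \<leadsto> N)"
    unfolding pred_tm_def tm_val.simps con_val.simps(3)
    by (rule app_in_dom[OF M app_in_dom[OF M Rec_in_dom[OF M] num_in_dom[OF M]] K_in_dom[OF M]])
  \<comment> \<open>The step function \<open>K\<close> returns the recursion index and discards the
    previous value; the start value 0 gives the truncation.\<close>
  have p_num: "app M ?p (num M n) = num M (n - 1)" for n
  proof -
    have "app M ?p (num M n)
        = rec_nat (num M 0) (\<lambda>m r. app M (app M (con_val M (K N N)) (num M m)) r) n"
      using app_Rec[OF M num_in_dom[OF M] K_in_dom[OF M]] by (simp add: pred_tm_def del: con_val.simps(1,2,4-))
    also have "\<dots> = num M (n - 1)"
    proof (induction n)
      case (Suc n)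
      then show ?case using app_K[OF M num_in_dom[OF M] num_in_dom[OF M], of n "n - 1"] by simp
    qed simp
    finally show ?thesis .
  qed
  have Kp: "app M (con_val M (K (N \<leadsto> N) N)) ?p \<in> dom M (N \<leadsto> N \<leadsto> N)"
    by (rule app_in_dom[OF M K_in_dom[OF M] p])
  obtain a where a: "x = num M a" using assms dom_N_cases by metis
  have "monus_val M x (num M n) = num M (a - n)" for n
  proof -
    \<comment> \<open>Here the outer \<open>K\<close> discards the recursion index, so the
      predecessor is iterated n times from \<open>x\<close>.\<close>
    have "monus_val M x (num M n) = rec_nat x (\<lambda>m r. app M ?p r) n"
      unfolding monus_val_def app_Rec[OF M assms(2) Kp] app_K[OF M p num_in_dom[OF M]] ..
    also have "\<dots> = num M (a - n)" by (induction n) (simp_all add: a p_num)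
    finally show ?thesis .
  qed
  then show ?thesis using a by simp
qed

section \<open>Evaluating the interpretation\<close>

text \<open>The carrier condition comes from the typed quantifier over members. Membership stays the
  value of the constant \<open>Mem\<close> and is handled as an arbitrary relation.\<close>

definition mem :: "'v struct \<Rightarrow> ty \<Rightarrow> 'v \<Rightarrow> 'v \<Rightarrow> bool" where
  "mem M \<sigma> v s \<longleftrightarrow> v \<in> dom M \<sigma> \<and> app M (app M (con_val M (Mem \<sigma>)) v) s = boole M True"

definition mems :: "'v struct \<Rightarrow> ty list \<Rightarrow> 'v list \<Rightarrow> 'v list \<Rightarrow> bool" where
  "mems M \<sigma>s vs ss \<longleftrightarrow> list_all2 (\<lambda>v (\<sigma>, s). mem M \<sigma> v s) vs (zip \<sigma>s ss)"

definition vapps :: "'v struct \<Rightarrow> 'v \<Rightarrow> 'v list \<Rightarrow> 'v" where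
  "vapps M h vs = foldl (app M) h vs"

text \<open>Counterpart of \<open>imp_interp\<close> on values: the block of bounded quantifiers
  over fresh variables becomes one quantifier over lists.\<close>

definition imp_sem ::
  "'v struct \<Rightarrow> nat \<Rightarrow> nat \<Rightarrow> ty list \<Rightarrow> ('v list \<Rightarrow> 'v list \<Rightarrow> bool) \<Rightarrow> ('v list \<Rightarrow> 'v list \<Rightarrow> bool)
     \<Rightarrow> 'v list \<Rightarrow> 'v list \<Rightarrow> bool" where
  "imp_sem M na nf \<beta>s P Q ws cs \<longleftrightarrow>
     (let as = take na cs; ds = drop na cs in
      (\<forall>bs. mems M \<beta>s bs (map (\<lambda>g. vapps M g (as @ ds)) (drop nf ws)) \<longrightarrow> P as bs)
        \<longrightarrow> Q (map (\<lambda>f. vapps M f as) (take nf ws)) ds)"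

primrec I_sem :: "'v struct \<Rightarrow> ty \<Rightarrow> 'v \<Rightarrow> 'v list \<Rightarrow> 'v list \<Rightarrow> bool" where
  "I_sem M N v ws cs \<longleftrightarrow> monus_val M v (hd ws) = num M 0"
| "I_sem M B v ws cs \<longleftrightarrow> True"
| "I_sem M (\<rho> \<leadsto> \<sigma>) v ws cs \<longleftrightarrow>
     (\<forall>x \<in> dom M \<rho>. imp_sem M (length (fst (I_types \<rho>))) (length (fst (I_types \<sigma>)))
        (snd (I_types \<rho>)) (I_sem M \<rho> x) (I_sem M \<sigma> (app M v x)) ws cs)"
| "I_sem M (Fin \<sigma>) v ws cs \<longleftrightarrow> True"

text \<open>Witnesses and counter-witnesses are lists of values, so fresh variables disappear; only
  source variables bound by the formula update the environment.\<close>

primrec U_sem :: "'v struct \<Rightarrow> ifm \<Rightarrow> (var \<Rightarrow> 'v) \<Rightarrow> 'v list \<Rightarrow> 'v list \<Rightarrow> bool" where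
  "U_sem M (IEq \<sigma> t u) e ws cs \<longleftrightarrow> tm_val M e t = tm_val M e u"
| "U_sem M IBot e ws cs \<longleftrightarrow> False"
| "U_sem M (IPred \<sigma> t) e ws cs \<longleftrightarrow> I_sem M \<sigma> (tm_val M e t) ws cs"
| "U_sem M (IAnd A A') e ws cs \<longleftrightarrow>
     U_sem M A e (take (length (wit_types A)) ws) (take (length (counter_types A)) cs) \<and>
     U_sem M A' e (drop (length (wit_types A)) ws) (drop (length (counter_types A)) cs)"
| "U_sem M (IImp A A') e ws cs \<longleftrightarrow>
     imp_sem M (length (wit_types A)) (length (wit_types A')) (counter_types A)
       (U_sem M A e) (U_sem M A' e) ws cs"
| "U_sem M (IAll i \<sigma> A) e ws cs \<longleftrightarrow> (\<forall>v \<in> dom M \<sigma>. U_sem M A (e(Src i \<sigma> := v)) ws cs)"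
| "U_sem M (IEx i \<sigma> A) e ws cs \<longleftrightarrow>
     (\<exists>v \<in> dom M \<sigma>. \<forall>bs. mems M (counter_types A) bs cs \<longrightarrow> U_sem M A (e(Src i \<sigma> := v)) ws bs)"

section \<open>Dependence on free variables only\<close>

primrec ifm_fv :: "ifm \<Rightarrow> var set" where
  "ifm_fv (IEq \<sigma> t u) = tm_vars t \<union> tm_vars u"
| "ifm_fv IBot = {}"
| "ifm_fv (IPred \<sigma> t) = tm_vars t"
| "ifm_fv (IAnd A A') = ifm_fv A \<union> ifm_fv A'"
| "ifm_fv (IImp A A') = ifm_fv A \<union> ifm_fv A'"
| "ifm_fv (IAll i \<sigma> A) = ifm_fv A - {Src i \<sigma>}"
| "ifm_fv (IEx i \<sigma> A) = ifm_fv A - {Src i \<sigma>}"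

lemma tm_val_cong: "(\<And>x. x \<in> tm_vars t \<Longrightarrow> e x = e' x) \<Longrightarrow> tm_val M e t = tm_val M e' t"
  by (induction t) auto

lemma U_sem_cong:
  "(\<And>x. x \<in> ifm_fv A \<Longrightarrow> e x = e' x) \<Longrightarrow> U_sem M A e = U_sem M A e'"
proof (induction A arbitrary: e e')
  case (IEq \<sigma> t u)
  then show ?case using tm_val_cong[of t e e' M] tm_val_cong[of u e e' M] by (intro ext) auto
next
  case (IPred \<sigma> t)
  then show ?case using tm_val_cong[of t e e' M] by (intro ext) auto
next
  case (IAnd A A')
  have "U_sem M A e = U_sem M A e'" by (rule IAnd.IH(1)) (use IAnd.prems in simp)
  moreover have "U_sem M A' e = U_sem M A' e'" by (rule IAnd.IH(2)) (use IAnd.prems in simp)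
  ultimately show ?case by (intro ext) simp
next
  case (IImp A A')
  have "U_sem M A e = U_sem M A e'" by (rule IImp.IH(1)) (use IImp.prems in simp)
  moreover have "U_sem M A' e = U_sem M A' e'" by (rule IImp.IH(2)) (use IImp.prems in simp)
  ultimately show ?case by (intro ext) simp
next
  case (IAll i \<sigma> A)
  have "U_sem M A (e(Src i \<sigma> := v)) = U_sem M A (e'(Src i \<sigma> := v))" for v
    by (rule IAll.IH) (use IAll.prems in auto)
  then show ?case by (intro ext) simp
next
  case (IEx i \<sigma> A)
  have "U_sem M A (e(Src i \<sigma> := v)) = U_sem M A (e'(Src i \<sigma> := v))" for v
    by (rule IEx.IH) (use IEx.prems in auto)
  then show ?case by (intro ext) simp
qed (simp add: fun_eq_iff)

section \<open>Blocks of bounded quantifiers\<close>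

primrec upd :: "(var \<Rightarrow> 'v) \<Rightarrow> var list \<Rightarrow> 'v list \<Rightarrow> var \<Rightarrow> 'v" where
  "upd e [] vs = e"
| "upd e (x # xs) vs = upd (e(x := hd vs)) xs (tl vs)"

lemma upd_other: "y \<notin> set xs \<Longrightarrow> upd e xs vs y = e y"
  by (induction xs arbitrary: e vs) auto

lemma map_upd: "distinct xs \<Longrightarrow> length vs = length xs \<Longrightarrow> map (upd e xs vs) xs = vs"
proof (induction xs arbitrary: e vs)
  case (Cons x xs)
  then show ?case by (cases vs) (auto simp: upd_other)
qed simp

lemma mems_length: "mems M \<sigma>s vs ss \<Longrightarrow> length ss = length \<sigma>s \<Longrightarrow> length vs = length \<sigma>s"
  by (auto simp: mems_def dest: list_all2_lengthD)

text \<open>No bound mentions a variable of the block, so the bounds keep their values while the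
  quantifiers are peeled off one by one.\<close>

lemma sat_TBalls:
  assumes "length ts = length xs" "distinct xs" "\<forall>t \<in> set ts. tm_vars t \<inter> set xs = {}"
  shows "sat M e (TBalls xs ts A) \<longleftrightarrow>
    (\<forall>vs. mems M (map var_ty xs) vs (map (tm_val M e) ts) \<longrightarrow> sat M (upd e xs vs) A)"
  using assms
proof (induction ts xs arbitrary: e rule: list_induct2)
  case Nil
  then show ?case by (simp add: TBalls_def mems_def)
next
  case (Cons t ts x xs)
  have ts: "map (tm_val M (e(x := v))) ts = map (tm_val M e) ts" for v
    by (rule map_cong[OF refl], rule tm_val_cong) (use Cons.prems in auto)
  have t: "tm_val M (e(x := v)) t = tm_val M e t" for v
    by (rule tm_val_cong) (use Cons.prems in auto)
  \<comment> \<open>Splits a quantifier over non-empty lists into head and tail, matching the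
    recursion of \<open>TBalls\<close>.\<close>
  have all_Cons: "(\<forall>vs. (\<exists>v us. vs = v # us \<and> R v us) \<longrightarrow> Q vs) \<longleftrightarrow> (\<forall>v. \<forall>us. R v us \<longrightarrow> Q (v # us))"
    for R :: "'a \<Rightarrow> 'a list \<Rightarrow> bool" and Q
    by blast
  have "sat M e (TBalls (x # xs) (t # ts) A) \<longleftrightarrow>
    (\<forall>v. mem M (var_ty x) v (tm_val M e t) \<longrightarrow> sat M (e(x := v)) (TBalls xs ts A))"
    by (auto simp: TBalls_def TMem_def mem_def t simp del: con_val.simps(12))
  also have "\<dots> \<longleftrightarrow> (\<forall>v. mem M (var_ty x) v (tm_val M e t) \<longrightarrow>
    (\<forall>vs. mems M (map var_ty xs) vs (map (tm_val M e) ts) \<longrightarrow> sat M (upd (e(x := v)) xs vs) A))"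
    using Cons.IH Cons.prems by (simp add: ts)
  also have "\<dots> \<longleftrightarrow> (\<forall>vs. mems M (map var_ty (x # xs)) vs (map (tm_val M e) (t # ts))
    \<longrightarrow> sat M (upd e (x # xs) vs) A)"
    by (simp add: mems_def list_all2_Cons2 all_Cons) blast
  finally show ?case .
qed

section \<open>The supply of fresh variables\<close>

abbreviation src_vars :: "var set" where
  "src_vars \<equiv> {Src i \<sigma> | i \<sigma>. True}"

text \<open>The auxiliary variables possibly in use before index \<open>k\<close>. Source variables
  are left out, so quantifiers of the formula cannot capture variables of terms over
  \<open>below k\<close>.\<close>

definition below :: "nat \<Rightarrow> var set" where
  "below k = {Aux i \<sigma> | i \<sigma>. i < k}"

lemma below_mono: "k \<le> k' \<Longrightarrow> below k \<subseteq> below k'"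
  by (auto simp: below_def)

lemma fresh_simps:
  shows length_fresh: "length (fresh k \<sigma>s) = length \<sigma>s"
    and distinct_fresh: "distinct (fresh k \<sigma>s)"
    and var_ty_fresh: "map var_ty (fresh k \<sigma>s) = \<sigma>s"
    and fresh_subset: "set (fresh k \<sigma>s) \<subseteq> below (k + length \<sigma>s) - below k"
proof -
  show "length (fresh k \<sigma>s) = length \<sigma>s" by (simp add: fresh_def)
  show "distinct (fresh k \<sigma>s)"
    by (auto simp: fresh_def distinct_conv_nth)
  show "map var_ty (fresh k \<sigma>s) = \<sigma>s"
    by (auto simp: fresh_def intro: nth_equalityI)
  show "set (fresh k \<sigma>s) \<subseteq> below (k + length \<sigma>s) - below k"
    by (auto simp: fresh_def below_def set_zip)
qed

section \<open>Tuples of terms and their values\<close>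

lemma tm_vars_apps: "tm_vars (apps t us) = tm_vars t \<union> \<Union> (tm_vars ` set us)"
  by (induction us arbitrary: t) (auto simp: apps_def)

lemma tm_val_apps: "tm_val M e (apps t us) = vapps M (tm_val M e t) (map (tm_val M e) us)"
  by (induction us arbitrary: t) (auto simp: apps_def vapps_def)

lemma length_imp_wit: "length (imp_wit as bs cs ds) = length cs + length bs"
  by (simp add: imp_wit_def)

definition vars_in :: "tm list \<Rightarrow> var set \<Rightarrow> bool" where
  "vars_in ts X \<longleftrightarrow> (\<forall>t \<in> set ts. tm_vars t \<subseteq> X)"

lemma vars_in_mono: "vars_in ts X \<Longrightarrow> X \<subseteq> Y \<Longrightarrow> vars_in ts Y"
  by (auto simp: vars_in_def)

lemma vars_in_take_drop: "vars_in ts X \<Longrightarrow> vars_in (take n ts) X" "vars_in ts X \<Longrightarrow> vars_in (drop n ts) X"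
  by (auto simp: vars_in_def dest: in_set_takeD in_set_dropD)

lemma vars_in_apps: "vars_in ts X \<Longrightarrow> vars_in us X \<Longrightarrow> vars_in (map (\<lambda>t. apps t us) ts) X"
  by (auto simp: vars_in_def tm_vars_apps)

lemma vals_unchanged:
  assumes "vars_in ts X" "\<And>x. x \<in> X \<Longrightarrow> e x = e' x"
  shows "map (tm_val M e) ts = map (tm_val M e') ts"
  by (rule map_cong[OF refl], rule tm_val_cong) (use assms in \<open>auto simp: vars_in_def\<close>)

lemma sat_TBalls_fresh:
  assumes "vars_in ts (below k)" "length ts = length \<beta>s"
  shows "sat M e (TBalls (fresh k \<beta>s) ts A) \<longleftrightarrow>
    (\<forall>vs. mems M \<beta>s vs (map (tm_val M e) ts) \<longrightarrow> sat M (upd e (fresh k \<beta>s) vs) A)"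
proof -
  have "\<forall>t \<in> set ts. tm_vars t \<inter> set (fresh k \<beta>s) = {}"
    using assms(1) fresh_subset[of k \<beta>s] by (fastforce simp: vars_in_def)
  then show ?thesis
    using sat_TBalls[of ts "fresh k \<beta>s"] assms(2)
    by (simp add: length_fresh distinct_fresh var_ty_fresh)
qed

lemma upd_fresh_below: "x \<in> below k \<Longrightarrow> upd e (fresh k \<beta>s) vs x = e x"
  using fresh_subset[of k \<beta>s] by (auto intro: upd_other)

lemma upd_fresh_Src: "upd e (fresh k \<beta>s) vs (Src i \<sigma>) = e (Src i \<sigma>)"
  using fresh_subset[of k \<beta>s] by (fastforce intro: upd_other simp: below_def)

lemma vals_fresh:
  assumes "length vs = length \<beta>s"
  shows "map (tm_val M (upd e (fresh k \<beta>s) vs)) (map Var (fresh k \<beta>s)) = vs"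
  using map_upd[of "fresh k \<beta>s" vs e] assms by (simp add: distinct_fresh length_fresh comp_def)

lemma vars_in_fresh: "vars_in (map Var (fresh k \<beta>s)) (below (k + length \<beta>s))"
  using fresh_subset[of k \<beta>s] by (auto simp: vars_in_def)

text \<open>Serves implications and \<open>I\<close> at function types alike. The premise is
  evaluated after the fresh variables receive values, so the hypothesis on \<open>P\<close> covers
  all environments agreeing with \<open>e\<close> off them; the conclusion is evaluated in
  \<open>e\<close> itself.\<close>

lemma sat_imp_interp:
  assumes ws: "vars_in ws (below k)" "length ws = nf + length \<beta>s"
    and cs: "vars_in cs (below k)" "length cs = na + nd"
    and P: "\<And>e' as bs. \<forall>x. x \<notin> set (fresh k \<beta>s) \<longrightarrow> e' x = e x
        \<Longrightarrow> vars_in as (below (k + length \<beta>s)) \<Longrightarrow> vars_in bs (below (k + length \<beta>s))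
        \<Longrightarrow> length as = na \<Longrightarrow> length bs = length \<beta>s
        \<Longrightarrow> sat M e' (P (k + length \<beta>s) as bs)
          \<longleftrightarrow> P' (map (tm_val M e') as) (map (tm_val M e') bs)"
    and Q: "\<And>fs ds. vars_in fs (below k) \<Longrightarrow> vars_in ds (below k)
        \<Longrightarrow> length fs = nf \<Longrightarrow> length ds = nd
        \<Longrightarrow> sat M e (Q k fs ds) \<longleftrightarrow> Q' (map (tm_val M e) fs) (map (tm_val M e) ds)"
  shows "sat M e (imp_interp na nf \<beta>s P Q k ws cs)
    \<longleftrightarrow> imp_sem M na nf \<beta>s P' Q' (map (tm_val M e) ws) (map (tm_val M e) cs)"
proof -
  let ?as = "take na cs" and ?ds = "drop na cs" and ?bs = "fresh k \<beta>s"
  let ?Bs = "map (\<lambda>g. apps g (?as @ ?ds)) (drop nf ws)"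
  let ?fs = "map (\<lambda>f. apps f ?as) (take nf ws)"
  have Bs: "vars_in ?Bs (below k)" "length ?Bs = length \<beta>s"
    using ws cs by (auto intro!: vars_in_apps vars_in_take_drop)
  \<comment> \<open>After the update the variables \<open>?bs\<close> evaluate to \<open>vs\<close>,
    while \<open>?as\<close>, built from older variables, keeps its values.\<close>
  have prem: "sat M (upd e ?bs vs) (P (k + length \<beta>s) ?as (map Var ?bs))
      \<longleftrightarrow> P' (map (tm_val M e) ?as) vs"
    if "mems M \<beta>s vs (map (tm_val M e) ?Bs)" for vs
  proof -
    have l: "length vs = length \<beta>s" using mems_length[OF that] Bs(2) by simp
    have "map (tm_val M (upd e ?bs vs)) ?as = map (tm_val M e) ?as"
      by (rule vals_unchanged[of _ "below k"])
        (use cs vars_in_take_drop upd_fresh_below in auto)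
    moreover have "vars_in ?as (below (k + length \<beta>s))"
      using vars_in_mono[OF vars_in_take_drop(1)[OF cs(1)] below_mono] by simp
    ultimately show ?thesis
      using P[of "upd e ?bs vs" ?as "map Var ?bs"] l cs(2)
      by (simp only: vals_fresh vars_in_fresh) (simp add: upd_other length_fresh)
  qed
  have "sat M e (Q k ?fs ?ds) \<longleftrightarrow> Q' (map (tm_val M e) ?fs) (map (tm_val M e) ?ds)"
    using ws cs by (intro Q) (auto intro!: vars_in_apps vars_in_take_drop)
  moreover have "map (tm_val M e) ?Bs = map (\<lambda>g. vapps M g (take na (map (tm_val M e) cs)
      @ drop na (map (tm_val M e) cs))) (drop nf (map (tm_val M e) ws))"
    "map (tm_val M e) ?fs = map (\<lambda>f. vapps M f (take na (map (tm_val M e) cs)))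
      (take nf (map (tm_val M e) ws))"
    by (simp_all add: tm_val_apps take_map drop_map flip: map_append)
  ultimately show ?thesis
    unfolding imp_interp_def imp_sem_def Let_def sat.simps sat_TBalls_fresh[OF Bs]
    using prem by (simp only: take_map drop_map) blast
qed

lemma length_I_types_Fun:
  "length (fst (I_types (\<rho> \<leadsto> \<sigma>))) = length (fst (I_types \<sigma>)) + length (snd (I_types \<rho>))"
  "length (snd (I_types (\<rho> \<leadsto> \<sigma>))) = length (fst (I_types \<rho>)) + length (snd (I_types \<sigma>))"
  by (simp_all add: Let_def split_beta length_imp_wit)

text \<open>At function types \<open>t\<close> is applied to a fresh auxiliary variable, so its
  variables may come from both supplies, whereas witnesses are confined to
  \<open>below k\<close>.\<close>

lemma sat_I_cb:
  assumes "tm_vars t \<subseteq> below k \<union> src_vars"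
    and "vars_in ws (below k)" "length ws = length (fst (I_types \<sigma>))"
    and "vars_in cs (below k)" "length cs = length (snd (I_types \<sigma>))"
  shows "sat M e (I_cb \<sigma> t k ws cs)
    \<longleftrightarrow> I_sem M \<sigma> (tm_val M e t) (map (tm_val M e) ws) (map (tm_val M e) cs)"
  using assms
proof (induction \<sigma> arbitrary: t k ws cs e)
  case N
  then show ?case by (cases ws) (auto simp: TLe_def tm_val_monus)
next
  case (Fun \<rho> \<sigma>)
  let ?x = "Aux k \<rho>"
  have x: "?x \<notin> below k" by (auto simp: below_def)
  have k: "below k \<subseteq> below (Suc k)" by (simp add: below_mono)
  have "sat M e' (imp_interp (length (fst (I_types \<rho>))) (length (fst (I_types \<sigma>)))
      (snd (I_types \<rho>)) (I_cb \<rho> (Var ?x)) (I_cb \<sigma> (t \<cdot> Var ?x)) (Suc k) ws cs)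
    \<longleftrightarrow> imp_sem M (length (fst (I_types \<rho>))) (length (fst (I_types \<sigma>)))
      (snd (I_types \<rho>)) (I_sem M \<rho> v) (I_sem M \<sigma> (app M (tm_val M e t) v))
      (map (tm_val M e) ws) (map (tm_val M e) cs)" if e': "e' = e(?x := v)" for e' v
  proof -
    \<comment> \<open>The bound variable has index \<open>k\<close>, so terms over
      \<open>below k\<close> do not see its value.\<close>
    have same: "map (tm_val M e') ws = map (tm_val M e) ws" "map (tm_val M e') cs = map (tm_val M e) cs"
      using x e' Fun.prems by (auto intro!: vals_unchanged simp del: map_eq_conv)
    have t: "tm_val M e' t = tm_val M e t"
      by (rule tm_val_cong) (use x e' Fun.prems(1) in auto)
    show ?thesis
      unfolding same[symmetric]
    proof (rule sat_imp_interp)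
      show "vars_in ws (below (Suc k))" "vars_in cs (below (Suc k))"
        using Fun.prems vars_in_mono k by blast+
      show "length ws = length (fst (I_types \<sigma>)) + length (snd (I_types \<rho>))"
        "length cs = length (fst (I_types \<rho>)) + length (snd (I_types \<sigma>))"
        using Fun.prems length_I_types_Fun by auto
    next
      let ?k = "Suc k + length (snd (I_types \<rho>))"
      fix e'' as bs
      assume *: "\<forall>x. x \<notin> set (fresh (Suc k) (snd (I_types \<rho>))) \<longrightarrow> e'' x = e' x"
        "vars_in as (below ?k)" "vars_in bs (below ?k)"
        "length as = length (fst (I_types \<rho>))" "length bs = length (snd (I_types \<rho>))"
      \<comment> \<open>The counter-witness block starts at \<open>Suc k\<close> and hence leaves
        the value \<open>v\<close> of \<open>?x\<close> intact.\<close>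
      have "?x \<notin> set (fresh (Suc k) (snd (I_types \<rho>)))"
        using fresh_subset by (fastforce simp: below_def)
      then have "e'' ?x = v" using * e' by simp
      moreover have "?x \<in> below ?k" by (simp add: below_def)
      ultimately show "sat M e'' (I_cb \<rho> (Var ?x) ?k as bs)
        \<longleftrightarrow> I_sem M \<rho> v (map (tm_val M e'') as) (map (tm_val M e'') bs)"
        using Fun.IH(1)[of "Var ?x" ?k as bs e''] * by simp
    next
      fix fs ds
      assume *: "vars_in fs (below (Suc k))" "vars_in ds (below (Suc k))"
        "length fs = length (fst (I_types \<sigma>))" "length ds = length (snd (I_types \<sigma>))"
      have "?x \<in> below (Suc k)" by (simp add: below_def)
      then have "tm_vars (t \<cdot> Var ?x) \<subseteq> below (Suc k) \<union> src_vars"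
        using k Fun.prems(1) by auto
      moreover have "e' ?x = v" using e' by simp
      ultimately show "sat M e' (I_cb \<sigma> (t \<cdot> Var ?x) (Suc k) fs ds)
        \<longleftrightarrow> I_sem M \<sigma> (app M (tm_val M e t) v) (map (tm_val M e') fs) (map (tm_val M e') ds)"
        using Fun.IH(2)[of "t \<cdot> Var ?x" "Suc k" fs ds e'] * t by simp
    qed
  qed
  then show ?case by (simp add: Let_def)
qed (auto simp: TTop_def)

lemma type_simps:
  "wit_types (IEq \<sigma> t u) = []" "counter_types (IEq \<sigma> t u) = []"
  "wit_types IBot = []" "counter_types IBot = []"
  "wit_types (IPred \<sigma> t) = fst (I_types \<sigma>)" "counter_types (IPred \<sigma> t) = snd (I_types \<sigma>)"
  "wit_types (IAnd A A') = wit_types A @ wit_types A'"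
  "counter_types (IAnd A A') = counter_types A @ counter_types A'"
  "wit_types (IImp A A') = imp_wit (wit_types A) (counter_types A) (wit_types A') (counter_types A')"
  "counter_types (IImp A A') = wit_types A @ counter_types A'"
  "wit_types (IAll i \<sigma> A) = wit_types A" "counter_types (IAll i \<sigma> A) = counter_types A"
  "wit_types (IEx i \<sigma> A) = wit_types A" "counter_types (IEx i \<sigma> A) = map Fin (counter_types A)"
  by (simp_all add: wit_types_def counter_types_def split_beta Let_def)

text \<open>Bridge from syntax to \<open>U_sem\<close>. The formula has only free source variables
  and the witnesses only older auxiliary ones, so neither kind of quantifier disturbs the other kind
  of variable.\<close>

lemma sat_U_interp:
  assumes "ifm_fv A \<subseteq> src_vars"
    and "vars_in ws (below k)" "length ws = length (wit_types A)"
    and "vars_in cs (below k)" "length cs = length (counter_types A)"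
  shows "sat M e (U_interp A k ws cs)
    \<longleftrightarrow> U_sem M A e (map (tm_val M e) ws) (map (tm_val M e) cs)"
  using assms
proof (induction A arbitrary: k ws cs e)
  case (IPred \<sigma> t)
  then show ?case by (simp add: type_simps sat_I_cb[OF le_supI2])
next
  case (IAnd A A')
  then show ?case
    by (simp add: type_simps Let_def vars_in_take_drop take_map drop_map)
next
  case (IImp A A')
  have "sat M e (imp_interp (length (wit_types A)) (length (wit_types A')) (counter_types A)
      (U_interp A) (U_interp A') k ws cs)
    \<longleftrightarrow> imp_sem M (length (wit_types A)) (length (wit_types A')) (counter_types A)
       (U_sem M A e) (U_sem M A' e) (map (tm_val M e) ws) (map (tm_val M e) cs)"
  proof (rule sat_imp_interp)
    fix e' as bs
    let ?k = "k + length (counter_types A)"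
    assume *: "\<forall>x. x \<notin> set (fresh k (counter_types A)) \<longrightarrow> e' x = e x"
        "vars_in as (below ?k)" "vars_in bs (below ?k)"
        "length as = length (wit_types A)" "length bs = length (counter_types A)"
    \<comment> \<open>The environments differ only at fresh auxiliary variables, none of which is
      free in \<open>A\<close>.\<close>
    have "U_sem M A e' = U_sem M A e"
    proof (rule U_sem_cong)
      fix x assume "x \<in> ifm_fv A"
      then have "x \<in> src_vars" using IImp.prems(1) by auto
      then have "x \<notin> set (fresh k (counter_types A))"
        using fresh_subset by (fastforce simp: below_def)
      then show "e' x = e x" using * by simp
    qed
    then show "sat M e' (U_interp A ?k as bs)
        \<longleftrightarrow> U_sem M A e (map (tm_val M e') as) (map (tm_val M e') bs)"
      using IImp.IH(1)[of as ?k bs e'] IImp.prems(1) * by simp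
  qed (use IImp in \<open>auto simp: type_simps length_imp_wit\<close>)
  then show ?case by simp
next
  case (IAll i \<sigma> A)
  \<comment> \<open>Assigning a source variable does not affect terms over
    \<open>below k\<close>.\<close>
  have same: "map (tm_val M (e(Src i \<sigma> := v))) ts = map (tm_val M e) ts" if "vars_in ts (below k)" for ts v
    using that by (rule vals_unchanged) (auto simp: below_def)
  have "ifm_fv A \<subseteq> src_vars" using IAll.prems(1) by auto
  then have "sat M (e(Src i \<sigma> := v)) (U_interp A k ws cs)
    \<longleftrightarrow> U_sem M A (e(Src i \<sigma> := v)) (map (tm_val M e) ws) (map (tm_val M e) cs)" for v
    using IAll.IH[of ws k cs "e(Src i \<sigma> := v)"] IAll.prems by (simp only: same type_simps)
  then show ?case by simp
next
  case (IEx i \<sigma> A)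
  let ?bs = "fresh k (counter_types A)" and ?k = "k + length (counter_types A)"
  have fv: "ifm_fv A \<subseteq> src_vars" using IEx.prems(1) by auto
  have len: "length cs = length (counter_types A)" "length ws = length (wit_types A)"
    using IEx.prems by (simp_all add: type_simps)
  have "sat M e' (TBalls ?bs cs (U_interp A ?k ws (map Var ?bs)))
    \<longleftrightarrow> (\<forall>bs. mems M (counter_types A) bs (map (tm_val M e) cs)
          \<longrightarrow> U_sem M A e' (map (tm_val M e) ws) bs)" if e': "e' = e(Src i \<sigma> := v)" for v e'
  proof -
    have same: "map (tm_val M e') ts = map (tm_val M e) ts" if "vars_in ts (below k)" for ts
      using that by (rule vals_unchanged) (auto simp: below_def e')
    have "sat M (upd e' ?bs vs) (U_interp A ?k ws (map Var ?bs))
        \<longleftrightarrow> U_sem M A e' (map (tm_val M e) ws) vs"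
      if "mems M (counter_types A) vs (map (tm_val M e) cs)" for vs
    proof -
      have l: "length vs = length (counter_types A)" using mems_length[OF that] len by simp
      have "U_sem M A (upd e' ?bs vs) = U_sem M A e'"
        by (rule U_sem_cong) (auto dest!: subsetD[OF fv] simp: upd_fresh_Src)
      moreover have "map (tm_val M (upd e' ?bs vs)) ws = map (tm_val M e) ws"
        unfolding same[OF IEx.prems(2), symmetric]
        by (rule vals_unchanged[OF IEx.prems(2)]) (simp add: upd_fresh_below)
      moreover have "vars_in ws (below ?k)"
        using vars_in_mono[OF IEx.prems(2) below_mono] by simp
      ultimately show ?thesis
        using IEx.IH[of ws ?k "map Var ?bs" "upd e' ?bs vs"] fv len(2) l
        by (simp only: vals_fresh vars_in_fresh) (simp add: length_fresh)
    qed
    then show ?thesis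
      using sat_TBalls_fresh[OF IEx.prems(4) len(1), of M e'] same[OF IEx.prems(4)] by simp
  qed
  then show ?case by (simp add: Let_def length_fresh)
qed auto

section \<open>Projections\<close>

lemma funs_simps: "funs [] = (\<lambda>\<tau>. \<tau>)" "funs (\<sigma> # \<sigma>s) \<tau> = \<sigma> \<leadsto> funs \<sigma>s \<tau>"
  by (simp_all add: funs_def fun_eq_iff)

lemma funs_append: "funs (\<sigma>s @ \<rho>s) \<tau> = funs \<sigma>s (funs \<rho>s \<tau>)"
  by (simp add: funs_def)

text \<open>Closed inhabitants; they later fill the slots for bounds on the counter-witnesses of the
  assumptions about free variables.\<close>

primrec default_tm :: "ty \<Rightarrow> tm" where
  "default_tm N = Con Zero"
| "default_tm B = Con Tt"
| "default_tm (\<rho> \<leadsto> \<sigma>) = Con (K \<sigma> \<rho>) \<cdot> default_tm \<sigma>"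
| "default_tm (Fin \<sigma>) = Con (Sing \<sigma>) \<cdot> default_tm \<sigma>"

lemma closed_default: "wit_ty \<tau> \<Longrightarrow> closed_wit_tm (default_tm \<tau>) \<tau>"
proof -
  have "tm_vars (default_tm \<tau>) = {} \<and> tm_ty (default_tm \<tau>) = Some \<tau>" by (induction \<tau>) auto
  then show "wit_ty \<tau> \<Longrightarrow> closed_wit_tm (default_tm \<tau>) \<tau>" by (simp add: closed_wit_tm_def)
qed

text \<open>\<open>first_tm \<rho> \<sigma>s\<close> is the term \<open>\<lambda>x\<^sup>\<rho>. \<lambda>y\<^sub>1 \<dots> y\<^sub>n. x\<close>, by the recursion \<open>\<lambda>x. K (F x) = S (K K) F\<close>.\<close>

primrec first_tm :: "ty \<Rightarrow> ty list \<Rightarrow> tm" where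
  "first_tm \<rho> [] = Con (S \<rho> (\<rho> \<leadsto> \<rho>) \<rho>) \<cdot> Con (K \<rho> (\<rho> \<leadsto> \<rho>)) \<cdot> Con (K \<rho> \<rho>)"
| "first_tm \<rho> (\<sigma> # \<sigma>s) =
     (let \<tau> = funs \<sigma>s \<rho> in
      Con (S \<rho> \<tau> (\<sigma> \<leadsto> \<tau>)) \<cdot> (Con (K (\<tau> \<leadsto> \<sigma> \<leadsto> \<tau>) \<rho>) \<cdot> Con (K \<tau> \<sigma>)) \<cdot> first_tm \<rho> \<sigma>s)"

text \<open>Each skipped leading argument costs one \<open>K\<close>. The empty list has nothing to
  select, and \<open>Zero\<close> is a dummy there.\<close>

primrec proj_tm :: "ty list \<Rightarrow> nat \<Rightarrow> tm" where
  "proj_tm [] p = Con Zero"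
| "proj_tm (\<sigma> # \<sigma>s) p = (case p of 0 \<Rightarrow> first_tm \<sigma> \<sigma>s
     | Suc q \<Rightarrow> Con (K (funs \<sigma>s (\<sigma>s ! q)) \<sigma>) \<cdot> proj_tm \<sigma>s q)"

lemma first_tm_closed:
  "tm_vars (first_tm \<rho> \<sigma>s) = {}" "tm_ty (first_tm \<rho> \<sigma>s) = Some (\<rho> \<leadsto> funs \<sigma>s \<rho>)"
  by (induction \<sigma>s) (simp_all add: Let_def funs_simps)

lemma proj_tm_closed:
  "p < length \<sigma>s \<Longrightarrow> tm_vars (proj_tm \<sigma>s p) = {} \<and> tm_ty (proj_tm \<sigma>s p) = Some (funs \<sigma>s (\<sigma>s ! p))"
  by (induction \<sigma>s arbitrary: p) (auto simp: first_tm_closed funs_simps split: nat.split)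

section \<open>Values of the projections\<close>

definition in_doms :: "'v struct \<Rightarrow> 'v list \<Rightarrow> ty list \<Rightarrow> bool" where
  "in_doms M vs \<sigma>s \<longleftrightarrow> list_all2 (\<lambda>v \<sigma>. v \<in> dom M \<sigma>) vs \<sigma>s"

lemma vapps_simps: "vapps M h [] = h" "vapps M h (v # vs) = vapps M (app M h v) vs"
  by (simp_all add: vapps_def)

lemma vapps_append: "vapps M h (us @ vs) = vapps M (vapps M h us) vs"
  by (simp add: vapps_def)

text \<open>The computation is S (K K) F x v = K (F x) v = F x. Membership in the carrier joins the
  induction because the rules for \<open>S\<close> and \<open>K\<close> need arguments in
  carriers.\<close>

lemma first_tm_val:
  assumes M: "full_struct M"
  shows "tm_val M e (first_tm \<rho> \<sigma>s) \<in> dom M (\<rho> \<leadsto> funs \<sigma>s \<rho>) \<and>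
    (\<forall>x vs. x \<in> dom M \<rho> \<longrightarrow> in_doms M vs \<sigma>s
      \<longrightarrow> vapps M (app M (tm_val M e (first_tm \<rho> \<sigma>s)) x) vs = x)"
proof (induction \<sigma>s)
  case Nil
  have "app M (app M (con_val M (S \<rho> (\<rho> \<leadsto> \<rho>) \<rho>)) (con_val M (K \<rho> (\<rho> \<leadsto> \<rho>)))) (con_val M (K \<rho> \<rho>))
      \<in> dom M (\<rho> \<leadsto> \<rho>)"
    by (rule app_in_dom[OF M app_in_dom[OF M S_in_dom[OF M] K_in_dom[OF M]] K_in_dom[OF M]])
  moreover have "app M (app M (app M (con_val M (S \<rho> (\<rho> \<leadsto> \<rho>) \<rho>)) (con_val M (K \<rho> (\<rho> \<leadsto> \<rho>))))
      (con_val M (K \<rho> \<rho>))) x = x" if "x \<in> dom M \<rho>" for x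
    unfolding app_S[OF M K_in_dom[OF M] K_in_dom[OF M] that]
    by (rule app_K[OF M that app_in_dom[OF M K_in_dom[OF M] that]])
  ultimately show ?case
    by (simp add: funs_simps in_doms_def vapps_simps del: con_val.simps)
next
  case (Cons \<sigma> \<sigma>s)
  define \<tau> where "\<tau> = funs \<sigma>s \<rho>"
  define F where "F = tm_val M e (first_tm \<rho> \<sigma>s)"
  have F: "F \<in> dom M (\<rho> \<leadsto> \<tau>)" using Cons by (simp add: F_def \<tau>_def)
  have KK: "app M (con_val M (K (\<tau> \<leadsto> \<sigma> \<leadsto> \<tau>) \<rho>)) (con_val M (K \<tau> \<sigma>)) \<in> dom M (\<rho> \<leadsto> \<tau> \<leadsto> \<sigma> \<leadsto> \<tau>)"
    by (rule app_in_dom[OF M K_in_dom[OF M] K_in_dom[OF M]])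
  have G: "tm_val M e (first_tm \<rho> (\<sigma> # \<sigma>s)) = app M (app M (con_val M (S \<rho> \<tau> (\<sigma> \<leadsto> \<tau>)))
      (app M (con_val M (K (\<tau> \<leadsto> \<sigma> \<leadsto> \<tau>) \<rho>)) (con_val M (K \<tau> \<sigma>)))) F" (is "?G = _")
    by (simp add: Let_def \<tau>_def F_def del: con_val.simps)
  have "?G \<in> dom M (\<rho> \<leadsto> \<sigma> \<leadsto> \<tau>)"
    unfolding G by (rule app_in_dom[OF M app_in_dom[OF M S_in_dom[OF M] KK] F])
  moreover have "app M (app M ?G x) v = app M F x" if x: "x \<in> dom M \<rho>" and v: "v \<in> dom M \<sigma>" for x v
    unfolding G app_S[OF M KK F x] app_K[OF M K_in_dom[OF M] x]
    by (rule app_K[OF M app_in_dom[OF M F x] v])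
  ultimately show ?case
    using Cons
    by (auto simp: funs_simps in_doms_def vapps_simps list_all2_Cons2 \<tau>_def F_def
        simp del: first_tm.simps)
qed

lemma proj_tm_val:
  assumes M: "full_struct M" and "p < length \<sigma>s"
  shows "tm_val M e (proj_tm \<sigma>s p) \<in> dom M (funs \<sigma>s (\<sigma>s ! p)) \<and>
    (\<forall>vs. in_doms M vs \<sigma>s \<longrightarrow> vapps M (tm_val M e (proj_tm \<sigma>s p)) vs = vs ! p)"
  using assms(2)
proof (induction \<sigma>s arbitrary: p)
  case (Cons \<sigma> \<sigma>s)
  show ?case
  proof (cases p)
    case 0
    then show ?thesis
      using first_tm_val[OF M, of e \<sigma> \<sigma>s]
      by (auto simp: funs_simps in_doms_def list_all2_Cons2 vapps_simps)
  next
    case (Suc q)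
    let ?F = "tm_val M e (proj_tm \<sigma>s q)" and ?\<tau> = "funs \<sigma>s (\<sigma>s ! q)"
    have IH: "?F \<in> dom M ?\<tau>" "\<And>vs. in_doms M vs \<sigma>s \<Longrightarrow> vapps M ?F vs = vs ! q"
      using Cons.IH[of q] Cons.prems Suc by auto
    have "app M (con_val M (K ?\<tau> \<sigma>)) ?F \<in> dom M (\<sigma> \<leadsto> ?\<tau>)"
      by (rule app_in_dom[OF M K_in_dom[OF M] IH(1)])
    then show ?thesis
      using IH(2) app_K[OF M IH(1)] Suc
      by (auto simp: funs_simps in_doms_def list_all2_Cons2 vapps_simps simp del: con_val.simps)
  qed
qed simp

text \<open>In effect the identity on the block \<open>\<tau>s\<close>, with the block
  \<open>\<sigma>s\<close> as parameters.\<close>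

definition projs :: "ty list \<Rightarrow> ty list \<Rightarrow> tm list" where
  "projs \<sigma>s \<tau>s = map (\<lambda>p. proj_tm (\<sigma>s @ \<tau>s) (length \<sigma>s + p)) [0..<length \<tau>s]"

lemma length_projs: "length (projs \<sigma>s \<tau>s) = length \<tau>s"
  by (simp add: projs_def)

lemma wit_ty_funs: "wit_ty (funs \<sigma>s \<tau>) \<longleftrightarrow> list_all wit_ty \<sigma>s \<and> wit_ty \<tau>"
  by (induction \<sigma>s) (auto simp: funs_simps)

lemma projs_closed:
  assumes "list_all wit_ty \<sigma>s" "list_all wit_ty \<tau>s"
  shows "list_all2 closed_wit_tm (projs \<sigma>s \<tau>s) (map (funs (\<sigma>s @ \<tau>s)) \<tau>s)"
  using assms proj_tm_closed[of "length \<sigma>s + p" "\<sigma>s @ \<tau>s" for p]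
  by (auto simp: list_all2_conv_all_nth projs_def closed_wit_tm_def wit_ty_funs list_all_length
      nth_append)

lemma projs_val:
  assumes "full_struct M" "in_doms M us \<sigma>s" "in_doms M vs \<tau>s"
  shows "map (\<lambda>h. vapps M h (us @ vs)) (map (tm_val M e) (projs \<sigma>s \<tau>s)) = vs"
proof (rule nth_equalityI)
  have len: "length us = length \<sigma>s" "length vs = length \<tau>s"
    using assms(2,3) by (auto simp: in_doms_def dest: list_all2_lengthD)
  show "length (map (\<lambda>h. vapps M h (us @ vs)) (map (tm_val M e) (projs \<sigma>s \<tau>s))) = length vs"
    by (simp add: length_projs len)
  fix p assume "p < length (map (\<lambda>h. vapps M h (us @ vs)) (map (tm_val M e) (projs \<sigma>s \<tau>s)))"
  then have p: "p < length \<tau>s" by (simp add: length_projs)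
  have "in_doms M (us @ vs) (\<sigma>s @ \<tau>s)"
    using assms(2,3) by (simp add: in_doms_def list_all2_appendI)
  then have "vapps M (tm_val M e (proj_tm (\<sigma>s @ \<tau>s) (length \<sigma>s + p))) (us @ vs)
      = (us @ vs) ! (length \<sigma>s + p)"
    using proj_tm_val[OF assms(1), of "length \<sigma>s + p" "\<sigma>s @ \<tau>s" e] p by simp
  then show "map (\<lambda>h. vapps M h (us @ vs)) (map (tm_val M e) (projs \<sigma>s \<tau>s)) ! p = vs ! p"
    using p len by (simp add: projs_def nth_append)
qed

section \<open>The collection principle\<close>

text \<open>Booleans contribute no witnesses, so \<open>B\<close> never enters a tuple; function
  types combine tuples by arrows and \<open>Fin\<close> only.\<close>

lemma I_types_wit: "list_all wit_ty (fst (I_types \<sigma>)) \<and> list_all wit_ty (snd (I_types \<sigma>))"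
  by (induction \<sigma>) (auto simp: Let_def split_beta imp_wit_def list_all_iff wit_ty_funs)

lemma interp_types_wit: "list_all wit_ty (wit_types A) \<and> list_all wit_ty (counter_types A)"
  by (induction A)
    (use I_types_wit in \<open>auto simp: type_simps imp_wit_def list_all_iff wit_ty_funs\<close>)

section \<open>Free variables of relativized formulas\<close>

lemma tm_vars_monus: "tm_vars (monus t u) = tm_vars t \<union> tm_vars u"
  by (simp add: monus_def pred_tm_def)

lemma ifm_fv_I_le1: "ifm_fv (I_le1 i) \<subseteq> {Src i (N \<leadsto> N)}"
  by (auto simp: I_le1_def ILe_def tm_vars_monus one_tm_def)

lemma ifm_fv_relativize: "ifm_fv (relativize A) \<subseteq> free_vars A"
  using ifm_fv_I_le1 by (induction A) (fastforce simp: ILe_def tm_vars_monus)+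

lemma tm_vars_Src: "src_symbols t \<Longrightarrow> tm_vars t \<subseteq> src_vars"
  by (induction t) auto

lemma free_vars_Src: "src_fm A \<Longrightarrow> free_vars A \<subseteq> src_vars"
  by (induction A) (use tm_vars_Src in \<open>auto simp: src_tm_def\<close>)

text \<open>The counter-witness is a bound m on the argument: the interpreted restriction says f n
  \<le> 1 only for n \<le> m.\<close>

lemma wit_types_I_le1: "wit_types (I_le1 i) = []" "counter_types (I_le1 i) = [N]"
  by (simp_all add: I_le1_def ILe_def type_simps imp_wit_def)

text \<open>The outer existential adds a set layer: entries of \<open>DD\<close> are finite sets of
  possible entries of \<open>Ds\<close>. For each such \<open>Ds\<close> and each admissible f the
  premise yields some n \<le> w, and k = w is independent of both. Since \<open>g\<close> is shared,
  f is tested up to the same bounds on both sides.\<close>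

lemma collection_sem:
  assumes M: "full_struct M" and lj: "l \<noteq> j" and l: "Src l N \<notin> free_vars C"
    and w: "w \<in> dom M N" and cv: "length cv = length (wit_types (relativize C))"
    and prem: "\<And>Ds. mems M (map Fin (counter_types (relativize C))) Ds DD
      \<Longrightarrow> U_sem M (relativize (SAllLe1 i (SEx j N C))) e (w # cv @ [g]) Ds"
  shows "U_sem M (relativize (SEx l N (SAllLe1 i (SExLe j (Var (Src l N)) C)))) e
    (w # cv @ [g]) DD"
proof -
  let ?C = "relativize C" and ?f = "Src i (N \<leadsto> N)" and ?n = "Src j N" and ?k = "Src l N"
  \<comment> \<open>The bound variable inside \<open>I_le1 i\<close> may coincide with
    \<open>?k\<close>, but only \<open>?f\<close> can be free there.\<close>
  have le1: "U_sem M (I_le1 i) (e(?k := w, ?f := f)) = U_sem M (I_le1 i) (e(?f := f))" for f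
    by (rule U_sem_cong) (use ifm_fv_I_le1 in auto)
  have C: "U_sem M ?C (e(?k := w, ?f := f, ?n := n)) = U_sem M ?C (e(?f := f, ?n := n))" for f n
    by (rule U_sem_cong) (use ifm_fv_relativize[of C] l in auto)
  note simps = type_simps wit_types_I_le1 imp_wit_def imp_sem_def Let_def ILe_def tm_val_monus cv
  show ?thesis
    \<comment> \<open>With k = w, \<open>monus_val_self\<close> yields the required k \<le> w;
      \<open>lj\<close> ensures that assigning \<open>?n\<close> does not overwrite
      \<open>?k\<close>.\<close>
    using prem w monus_val_self[OF M w] lj
    by (fastforce simp: simps vapps_simps le1 C)
qed

text \<open>Leading universal quantifiers leave the witness and counter-witness types alone, and a
  body true in every environment stays true under them.\<close>

lemma I_closure_simps:
  fixes xs
  defines "X \<equiv> foldr (\<lambda>(i, \<sigma>). IAnd (IPred \<sigma> (Var (Src i \<sigma>)))) xs ITop"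
  shows wit_types_I_closure: "wit_types (I_closure xs A) = wit_types (IImp X A)"
    and counter_types_I_closure: "counter_types (I_closure xs A) = counter_types (IImp X A)"
    and U_sem_I_closure: "(\<And>e. U_sem M (IImp X A) e ws cs) \<Longrightarrow> U_sem M (I_closure xs A) e ws cs"
    and ifm_fv_I_closure: "ifm_fv A \<subseteq> src_vars \<Longrightarrow>
      ifm_fv (I_closure xs A) \<subseteq> src_vars"
proof -
  have "wit_types (foldr (\<lambda>(i, \<sigma>). IAll i \<sigma>) ys D) = wit_types D"
    "counter_types (foldr (\<lambda>(i, \<sigma>). IAll i \<sigma>) ys D) = counter_types D"
    "ifm_fv (foldr (\<lambda>(i, \<sigma>). IAll i \<sigma>) ys D) \<subseteq> ifm_fv D"
    "(\<And>e. U_sem M D e ws cs) \<Longrightarrow> U_sem M (foldr (\<lambda>(i, \<sigma>). IAll i \<sigma>) ys D) e ws cs" for ys D e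
    by (induction ys arbitrary: e) (auto simp: type_simps)
  note closure = this
  have "ifm_fv X \<subseteq> src_vars"
    unfolding X_def by (induction xs) (auto simp: ITop_def)
  then show "ifm_fv A \<subseteq> src_vars \<Longrightarrow> ifm_fv (I_closure xs A) \<subseteq> src_vars"
    using closure(3)[of xs "IImp X A"] by (simp add: I_closure_def X_def) blast
  show "wit_types (I_closure xs A) = wit_types (IImp X A)"
    "counter_types (I_closure xs A) = counter_types (IImp X A)"
    "(\<And>e. U_sem M (IImp X A) e ws cs) \<Longrightarrow> U_sem M (I_closure xs A) e ws cs"
    unfolding I_closure_def X_def by (rule closure; assumption?)+
qed

lemma T_proves_TAlls:
  assumes "\<And>e. (\<And>x. e x \<in> dom M (var_ty x)) \<Longrightarrow> sat M e A"
  shows "T_proves M (TAlls xs A)"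
proof -
  have "sat M e (TAlls xs A)" if "\<And>x. e x \<in> dom M (var_ty x)" for e
    using that by (induction xs arbitrary: e) (auto simp: TAlls_def assms)
  then show ?thesis by (simp add: T_proves_def)
qed

theorem theorem9p18:
  fixes M :: "'v struct" and C :: sfm and i j l :: nat
  assumes "full_struct M"
    and "src_fm C"
    and "l \<noteq> j" and "Src l N \<notin> free_vars C"
  shows "I_cb_interpretable M (collection i j l C)"
  unfolding I_cb_interpretable_def
proof (intro allI impI)
  fix xs
  define X where "X = foldr (\<lambda>(i, \<sigma>). IAnd (IPred \<sigma> (Var (Src i \<sigma>)))) xs ITop"
  define P where "P = relativize (SAllLe1 i (SEx j N C))"
  define Q where "Q = relativize (SEx l N (SAllLe1 i (SExLe j (Var (Src l N)) C)))"
  let ?A = "relativize (collection i j l C)"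
  define as where "as = wit_types X"
  define \<beta>s where "\<beta>s = counter_types X"
  define W where "W = wit_types P"
  define Cp where "Cp = counter_types P"
  define Cq where "Cq = map Fin Cp"
  have A: "?A = IImp P Q" by (simp add: collection_def P_def Q_def)
  \<comment> \<open>The outer existential of \<open>Q\<close> accounts for the extra
    \<open>Fin\<close> in \<open>Cq\<close>. Thus a bound on counter-witnesses of \<open>P\<close>
    has exactly the type of a counter-witness of \<open>Q\<close>.\<close>
  have W: "W = N # wit_types (relativize C) @ [funs Cp (Fin N)]"
    and Cp: "Cp = map Fin (counter_types (relativize C))"
    and Q: "wit_types Q = W" "counter_types Q = Cq"
    by (simp_all add: W_def P_def Cp_def Cq_def Q_def type_simps wit_types_I_le1 imp_wit_def ILe_def
        funs_simps)
  \<comment> \<open>The first block hands the witnesses of \<open>P\<close> to \<open>Q\<close>; the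
    second returns the counter-witnesses of \<open>Q\<close> as the sets over which \<open>P\<close>
    is demanded; the defaults bound the counter-witnesses of \<open>X\<close>.\<close>
  define ts where "ts = projs as W @ projs (as @ W) Cq
    @ map (\<lambda>\<beta>. default_tm (funs (as @ W @ Cq) (Fin \<beta>))) \<beta>s"
  have types: "wit_types (I_closure xs ?A) = map (funs (as @ W)) W @ map (funs ((as @ W) @ Cq)) Cq
      @ map (\<lambda>\<beta>. funs (as @ W @ Cq) (Fin \<beta>)) \<beta>s"
    "counter_types (I_closure xs ?A) = as @ W @ Cq"
    unfolding wit_types_I_closure counter_types_I_closure X_def[symmetric] A
    by (simp_all add: type_simps imp_wit_def Q as_def \<beta>s_def flip: W_def Cp_def)
      (simp_all add: Cq_def funs_append)
  have wit: "list_all wit_ty as" "list_all wit_ty W" "list_all wit_ty Cq" "list_all wit_ty \<beta>s"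
    unfolding as_def W_def \<beta>s_def Q(2)[symmetric] by (simp_all add: interp_types_wit)
  have closed: "list_all2 closed_wit_tm ts (wit_types (I_closure xs ?A))"
    unfolding types ts_def
  proof (intro list_all2_appendI projs_closed)
    show "list_all2 closed_wit_tm (map (\<lambda>\<beta>. default_tm (funs (as @ W @ Cq) (Fin \<beta>))) \<beta>s)
        (map (\<lambda>\<beta>. funs (as @ W @ Cq) (Fin \<beta>)) \<beta>s)"
      using wit by (auto simp: list_all2_map1 list_all2_map2 wit_ty_funs list_all_iff
          intro!: list.rel_refl_strong closed_default)
  qed (use wit in auto)
  let ?bs = "fresh 0 (as @ W @ Cq)"
  have "sat M e (U_interp (I_closure xs ?A) (length ?bs) ts (map Var ?bs))"
    if e: "\<And>x. e x \<in> dom M (var_ty x)" for e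
  proof -
    \<comment> \<open>The outermost quantifiers amount to an arbitrary well-typed environment;
      \<open>vs\<close> lists its counter-witnesses.\<close>
    define vs where "vs = map e ?bs"
    have "in_doms M vs (map var_ty ?bs)"
      unfolding in_doms_def vs_def list_all2_map1 list_all2_map2 by (rule list_all2_refl) (rule e)
    then have vs: "in_doms M vs (as @ W @ Cq)" by (simp only: var_ty_fresh)
    then obtain asv Wv DD where vs_eq: "vs = asv @ Wv @ DD"
      and asv: "in_doms M asv as" and Wv: "in_doms M Wv W" and DD: "in_doms M DD Cq"
      unfolding in_doms_def list_all2_append2 by blast
    have len: "length asv = length as" "length Wv = length W" "length DD = length Cq"
      using asv Wv DD by (auto simp: in_doms_def dest: list_all2_lengthD)
    obtain w cv g where w: "Wv = w # cv @ [g]" "w \<in> dom M N"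
      and cv: "length cv = length (wit_types (relativize C))"
      using Wv unfolding W in_doms_def
      by (auto simp: list_all2_Cons2 list_all2_append2 dest: list_all2_lengthD)
    have concl: "U_sem M Q e' Wv DD" if "\<And>Ds. mems M Cp Ds DD \<Longrightarrow> U_sem M P e' Wv Ds" for e'
      using that collection_sem[OF assms(1,3,4) w(2) cv] unfolding P_def Q_def Cp w(1) by blast
    let ?F = "map (tm_val M e) (projs as W)" and ?G = "map (tm_val M e) (projs (as @ W) Cq)"
    have F: "map (\<lambda>h. vapps M (vapps M h asv) Wv) ?F = Wv"
      using projs_val[OF assms(1) asv Wv] by (simp only: vapps_append)
    have "in_doms M (asv @ Wv) (as @ W)"
      using asv Wv by (simp add: in_doms_def list_all2_appendI)
    from projs_val[OF assms(1) this DD]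
    have G: "map (\<lambda>h. vapps M (vapps M h asv) (Wv @ DD)) ?G = DD"
      by (simp only: vapps_append append_assoc)
    \<comment> \<open>After application to \<open>asv\<close>, the projections return
      \<open>Wv\<close> and \<open>DD\<close>, so the implication reduces to \<open>concl\<close>.
      It holds in every environment, as the closure over \<open>xs\<close> requires.\<close>
    have A_sem: "U_sem M ?A e' (map (\<lambda>f. vapps M f asv) (?F @ ?G)) (Wv @ DD)" for e'
      using F G concl[of e']
      unfolding A U_sem.simps imp_sem_def Let_def Q W_def[symmetric] Cp_def[symmetric]
      by (simp add: length_projs len comp_def)
    have "U_sem M (IImp X ?A) e' (map (tm_val M e) ts) vs" for e'
    proof -
      have "length (wit_types ?A) = length W + length Cq"
        by (simp add: A type_simps length_imp_wit Q Cq_def flip: W_def Cp_def)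
      then show ?thesis
        using A_sem[of e'] unfolding U_sem.simps imp_sem_def Let_def as_def[symmetric] vs_eq ts_def
        by (simp add: length_projs len)
    qed
    then have "U_sem M (I_closure xs ?A) e (map (tm_val M e) ts) vs"
      unfolding X_def by (rule U_sem_I_closure)
    moreover have "vs = map (tm_val M e) (map Var ?bs)" by (simp add: vs_def)
    moreover have "ifm_fv (I_closure xs ?A) \<subseteq> src_vars"
    proof (rule ifm_fv_I_closure)
      have "free_vars (collection i j l C) \<subseteq> src_vars"
        by (rule free_vars_Src) (use assms(2,3) in \<open>simp add: collection_def src_tm_def eq_commute\<close>)
      then show "ifm_fv ?A \<subseteq> src_vars" using ifm_fv_relativize by blast
    qed
    \<comment> \<open>Closed terms contain no variables at all.\<close>
    moreover have "vars_in ts (below (length ?bs))"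
      using closed by (auto simp: vars_in_def in_set_conv_nth list_all2_conv_all_nth closed_wit_tm_def)
    moreover have "vars_in (map Var ?bs) (below (length ?bs))"
      using vars_in_fresh[of 0 "as @ W @ Cq"] by (simp add: length_fresh)
    ultimately show ?thesis
      using sat_U_interp[of "I_closure xs ?A" ts "length ?bs" "map Var ?bs" M e]
        list_all2_lengthD[OF closed] by (simp add: types length_fresh)
  qed
  then show "U_interpretable M (I_closure xs ?A)"
    unfolding U_interpretable_def Let_def types(2)
    by (intro exI[of _ ts] conjI closed T_proves_TAlls) auto
qed

end
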